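(* Let $\mathbb{F}$ be the field with $2$ elements and let $V$ be a non-degenerate symplectic space of dimension $n=6$ over $\mathbb{F}$. Let $p$ be a $1$-dimensional subspace of $V$ and let $H$ be a complement of $p$ in $V$. Then the fundamental group of the geometry $\Pi(p,H)$ is $\mathbb{Z}/2\mathbb{Z}$.
   Context: For $U\le V$ let $U^\perp$ be its orthogonal with respect to the symplectic form and $\mathrm{Rad}(U)=U\cap U^\perp$. The geometry $\Pi(p,H)$: its objects are the non-zero proper subspaces $U$ of $H$ such that $U\not\subseteq p^\perp$, $\dim\mathrm{Rad}(U)\le 2$, and either $\mathrm{Rad}(U)=\{0\}$ or $\mathrm{Rad}(U)\not\subseteq p^\perp$. The type of $U$ is $\dim U\in\{1,2,3,4\}$. For objects $U,W$ with $\dim U<\dim W$, $U$ and $W$ are incident iff either $\dim W$ is odd and $U\subseteq W$, or $\dim W$ is even, $U\subseteq W$ and $\mathrm{Rad}(W\cap p^\perp)\not\subseteq U$ (here $\mathrm{Rad}(W\cap p^\perp)$ is $1$-dimensional). Each object is incident with itself; distinct objects of equal dimension are not incident. Fundamental group: a path is a sequence of objects $x_0,\dots,x_k$ with consecutive objects distinct and incident; a cycle based at $x$ is a path with $x_0=x=x_k$. Two paths are homotopy equivalent if one is obtained from the other by a finite number of insertions or eliminations of cycles of length $2$ or $3$. The homotopy classes of cycles based at an object $x$ form a group under concatenation; for a connected geometry its isomorphism type does not depend on $x$ and it is called the fundamental group. *)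

theory Defs
  imports Complex_Main "HOL-Algebra.Elementary_Groups" "HOL-Library.Cardinality"
begin

record ('o, 't) geometry =
  objects :: "'o set"
  obj_type :: "'o \<Rightarrow> 't"
  incident :: "'o \<Rightarrow> 'o \<Rightarrow> bool"

text \<open>A path \<open>x\<^sub>0, \<dots>, x\<^sub>k\<close> is the list of its \<open>k + 1\<close> objects.\<close>

definition is_path :: "('o, 't, 'm) geometry_scheme \<Rightarrow> 'o list \<Rightarrow> bool" where
  "is_path G xs \<longleftrightarrow> xs \<noteq> [] \<and> set xs \<subseteq> objects G \<and>
     successively (\<lambda>x y. x \<noteq> y \<and> incident G x y) xs"

definition cycles_at :: "('o, 't, 'm) geometry_scheme \<Rightarrow> 'o \<Rightarrow> 'o list set" where
  "cycles_at G x = {c. is_path G c \<and> hd c = x \<and> last c = x}"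

definition path_length :: "'o list \<Rightarrow> nat" where
  "path_length xs = length xs - 1"

definition connected_geometry :: "('o, 't, 'm) geometry_scheme \<Rightarrow> bool" where
  "connected_geometry G \<longleftrightarrow> objects G \<noteq> {} \<and>
     (\<forall>x \<in> objects G. \<forall>y \<in> objects G. \<exists>xs. is_path G xs \<and> hd xs = x \<and> last xs = y)"

text \<open>Insertion of a cycle of length 2 or 3, based at an object \<open>x\<close> of a path, at an
  occurrence of \<open>x\<close> in that path.\<close>

definition cycle_insertion :: "('o, 't, 'm) geometry_scheme \<Rightarrow> ('o list \<times> 'o list) set" where
  "cycle_insertion G = {(xs @ [x] @ ys, xs @ c @ ys) | xs x ys c.
     is_path G (xs @ [x] @ ys) \<and> c \<in> cycles_at G x \<and> path_length c \<in> {2, 3}}"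

definition homotopy :: "('o, 't, 'm) geometry_scheme \<Rightarrow> ('o list \<times> 'o list) set" where
  "homotopy G = (cycle_insertion G \<union> (cycle_insertion G)\<inverse>)\<^sup>*"

text \<open>\<open>xs @ tl ys\<close> is the concatenation of \<open>xs\<close> and \<open>ys\<close> when \<open>last xs = hd ys\<close>. The unions
  below run over all representatives of the two classes.\<close>

definition fundamental_group :: "('o, 't, 'm) geometry_scheme \<Rightarrow> 'o \<Rightarrow> 'o list set monoid" where
  "fundamental_group G x =
     \<lparr>carrier = cycles_at G x // homotopy G,
      mult = (\<lambda>A B. \<Union>xs\<in>A. \<Union>ys\<in>B. homotopy G `` {xs @ tl ys}),
      one = homotopy G `` {[x]}\<rparr>"

text \<open>The symplectic space \<open>V\<close> is the whole type \<open>'v\<close>.\<close>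

locale symplectic_space = vector_space scale
  for scale :: "'f::field \<Rightarrow> 'v::ab_group_add \<Rightarrow> 'v" (infixr \<open>*s\<close> 75) +
  fixes form :: "'v \<Rightarrow> 'v \<Rightarrow> 'f"
  assumes form_linear_left: "Vector_Spaces.linear scale (*) (\<lambda>u. form u v)"
    and form_linear_right: "Vector_Spaces.linear scale (*) (\<lambda>v. form u v)"
    and form_alternating: "form v v = 0"
    and form_nondegenerate: "(\<forall>v. form u v = 0) \<Longrightarrow> u = 0"
begin

definition perp :: "'v set \<Rightarrow> 'v set" where
  "perp U = {v. \<forall>u \<in> U. form u v = 0}"

definition Rad :: "'v set \<Rightarrow> 'v set" where
  "Rad U = U \<inter> perp U"

definition is_complement :: "'v set \<Rightarrow> 'v set \<Rightarrow> bool" where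
  "is_complement H p \<longleftrightarrow> subspace H \<and> p \<inter> H = {0} \<and> {u + w | u w. u \<in> p \<and> w \<in> H} = UNIV"

definition Pi_objects :: "'v set \<Rightarrow> 'v set \<Rightarrow> 'v set set" where
  "Pi_objects p H = {U. subspace U \<and> U \<noteq> {0} \<and> U \<subset> H \<and> \<not> U \<subseteq> perp p \<and>
     dim (Rad U) \<le> 2 \<and> (Rad U = {0} \<or> \<not> Rad U \<subseteq> perp p)}"

text \<open>Incidence of \<open>U\<close> and \<open>W\<close> in the case \<open>dim U < dim W\<close>:\<close>

definition Pi_below :: "'v set \<Rightarrow> 'v set \<Rightarrow> 'v set \<Rightarrow> bool" where
  "Pi_below p U W \<longleftrightarrow> (odd (dim W) \<and> U \<subseteq> W) \<or>
     (even (dim W) \<and> U \<subseteq> W \<and> \<not> Rad (W \<inter> perp p) \<subseteq> U)"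

definition Pi_incident :: "'v set \<Rightarrow> 'v set \<Rightarrow> 'v set \<Rightarrow> bool" where
  "Pi_incident p U W \<longleftrightarrow> U = W \<or> (dim U < dim W \<and> Pi_below p U W) \<or>
     (dim W < dim U \<and> Pi_below p W U)"

definition Pi_geometry :: "'v set \<Rightarrow> 'v set \<Rightarrow> ('v set, nat) geometry" where
  "Pi_geometry p H =
     \<lparr>objects = Pi_objects p H, obj_type = dim, incident = Pi_incident p\<rparr>"

end

end

theory Submission
  imports Defs
begin

text \<open>Write \<open>p = {0, p0}\<close>. Over the field with two elements an object is determined by its \<^emph>\<open>points\<close>, the
vectors \<open>a \<in> H\<close> with \<open>form p0 a = 1\<close>. They form an affine space with translation space
\<open>K = {k \<in> H. form p0 k = 0}\<close>, which is symplectic, non-degenerate and of dimension 4. The objects of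
dimension 1 are the points, those of dimension 2 are the pairs of points. Call a triangle \<open>a, b, c\<close>
of points hyperbolic if \<open>form (a + b) (a + c) = 1\<close> and isotropic otherwise. A hyperbolic triangle
spans a plane of the geometry (\<open>plane_object\<close>), so it is null-homotopic. Conversely, every
object, restricted to the lines incident with it, contains only hyperbolic triangles
(\<open>joined_triangle\<close>); in dimension 4 this is the effect of the radical condition in the incidence,
which removes the lines \<open>{a, b}\<close> with \<open>a + b\<close> in the radical. So the fundamental group is that of the complete
graph on the points with the hyperbolic triangles filled in.

At least two classes: the function \<open>form a b + 1\<close> of pairs of distinct points adds up to 0 around
a hyperbolic triangle and to 1 around an isotropic one. Inside one object it is the
coboundary of a potential (\<open>potential_joined\<close>), and comparing the potentials of two incident objects
gives a cocycle on all edges of the geometry (\<open>transition_cocycle\<close>). Its sum along a path, the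
holonomy, is a homotopy invariant, and it is 1 on an isotropic triangle (\<open>odd_cycle\<close>).

At most two classes: conjugating edges back to the base object gives a cocycle on the
edges with values in the fundamental group, whose products along cycles are all classes (\<open>edge_cocycle\<close>).
On points written as \<open>o + k\<close> with \<open>k \<in> K\<close>, and normalised to be trivial on the edges at \<open>o\<close>, it
is trivial on pairs \<open>k, l\<close> with \<open>form k l = 1\<close>, since these form a hyperbolic triangle with \<open>o\<close>.
Hyperbolic triangles with just one such side show that its value on an orthogonal pair
\<open>k, l\<close> does not depend on \<open>k\<close>. Running through a totally isotropic plane \<open>{0, k, l, k + l}\<close> makes
the value independent of the order of \<open>k, l\<close> and an involution, and since any two non-zero vectors of \<open>K\<close>
have a common non-zero orthogonal vector, all orthogonal pairs have the same value
(\<open>isotropic_generator\<close>). A change of gauge extends this from points to all objects (\<open>edge_gauge\<close>).\<close>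

section \<open>Homotopy of paths\<close>

lemma equiv_homotopy: "equiv UNIV (homotopy G)"
  unfolding homotopy_def
  by (intro equivI) (auto intro: refl_rtrancl sym_rtrancl sym_Un_converse trans_rtrancl simp: Un_commute)

lemma homotopy_sym: "(xs, ys) \<in> homotopy G \<Longrightarrow> (ys, xs) \<in> homotopy G"
  using equiv_homotopy by (meson equivE symD)

lemma homotopy_trans: "(xs, ys) \<in> homotopy G \<Longrightarrow> (ys, zs) \<in> homotopy G \<Longrightarrow> (xs, zs) \<in> homotopy G"
  using equiv_homotopy by (meson equivE transD)

lemma homotopy_refl [simp]: "(xs, xs) \<in> homotopy G"
  by (simp add: homotopy_def)

lemma insertion_homotopy:
  assumes "is_path G (xs @ [x] @ ys)" "c \<in> cycles_at G x" "path_length c \<in> {2, 3}"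
  shows "(xs @ [x] @ ys, xs @ c @ ys) \<in> homotopy G"
proof -
  have "(xs @ [x] @ ys, xs @ c @ ys) \<in> cycle_insertion G"
    using assms unfolding cycle_insertion_def by blast
  then show ?thesis unfolding homotopy_def by blast
qed

lemma path_nonempty: "is_path G xs \<Longrightarrow> xs \<noteq> []"
  by (simp add: is_path_def)

lemma is_path_append:
  assumes "is_path G xs" "is_path G ys" "last xs = hd ys"
  shows "is_path G (xs @ tl ys)"
  using assms unfolding is_path_def
  by (cases ys; cases "tl ys") (auto simp: successively_append_iff)

lemma path_split_iff:
  "is_path G (u @ x # v) \<longleftrightarrow> is_path G (u @ [x]) \<and> is_path G (x # v)"
  unfolding is_path_def
  by (cases v) (auto simp: successively_append_iff)

lemma last_append_tl: "xs \<noteq> [] \<Longrightarrow> ys \<noteq> [] \<Longrightarrow> last xs = hd ys \<Longrightarrow> last (xs @ tl ys) = last ys"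
  by (cases ys; cases "tl ys") auto

lemma splice_cycle:
  assumes "c \<in> cycles_at G x"
  shows "is_path G (u @ c @ v) \<longleftrightarrow> is_path G (u @ x # v)"
    and "hd (u @ c @ v) = hd (u @ x # v)" "last (u @ c @ v) = last (u @ x # v)"
proof -
  obtain c' where c': "c = x # c'"
    using assms by (cases c) (auto simp: cycles_at_def is_path_def)
  have c: "is_path G c" and "last c = x" using assms by (auto simp: cycles_at_def)
  then obtain c'' where c'': "c = c'' @ [x]"
    by (metis append_butlast_last_id path_nonempty)
  have "is_path G (u @ c @ v) \<longleftrightarrow> is_path G (u @ [x]) \<and> is_path G (x # c' @ v)"
    using path_split_iff[of G u x "c' @ v"] c' by simp
  also have "x # c' @ v = c'' @ x # v"
  proof -
    have "(x # c') @ v = (c'' @ [x]) @ v" using c' c'' by simp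
    then show ?thesis by simp
  qed
  also have "is_path G (c'' @ x # v) \<longleftrightarrow> is_path G (x # v)"
    using c c'' path_split_iff[of G c'' x v] by simp
  finally show "is_path G (u @ c @ v) \<longleftrightarrow> is_path G (u @ x # v)"
    using path_split_iff[of G u x v] by simp
  show "hd (u @ c @ v) = hd (u @ x # v)" using c' by (cases u) auto
  show "last (u @ c @ v) = last (u @ x # v)" using c'' by (cases v) auto
qed

lemma homotopy_path:
  assumes "(xs, ys) \<in> homotopy G"
  shows "(is_path G ys \<longleftrightarrow> is_path G xs) \<and> hd ys = hd xs \<and> last ys = last xs"
  using assms unfolding homotopy_def
proof (induction rule: rtrancl_induct)
  case base
  show ?case by simp
next
  case (step y z)
  have "(is_path G b \<longleftrightarrow> is_path G a) \<and> hd b = hd a \<and> last b = last a"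
    if ab: "(a, b) \<in> cycle_insertion G" for a b
  proof -
    obtain u x v c where *: "a = u @ x # v" "b = u @ c @ v" "c \<in> cycles_at G x"
      using ab unfolding cycle_insertion_def mem_Collect_eq prod.inject append_Cons append_Nil by blast
    show ?thesis using splice_cycle[OF *(3), of u v] unfolding *(1,2) by blast
  qed
  from this[of y z] this[of z y] step(2,3) show ?case by (elim UnE converseE) simp_all
qed

text \<open>A homotopy consists of insertions and their inverses. A function that respects an
equivalence therefore only has to be tested on insertions, and these can be taken between paths with
the ends of \<open>xs\<close>, because homotopies preserve paths and their ends.\<close>
lemma homotopy_map:
  assumes "(xs, ys) \<in> homotopy G" "is_path G xs" "equiv UNIV r"
    and step: "\<And>u x v c. is_path G (u @ x # v) \<Longrightarrow> hd (u @ x # v) = hd xs \<Longrightarrow> last (u @ x # v) = last xs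
      \<Longrightarrow> c \<in> cycles_at G x \<Longrightarrow> path_length c \<in> {2, 3} \<Longrightarrow> (f (u @ x # v), f (u @ c @ v)) \<in> r"
  shows "(f xs, f ys) \<in> r"
  using assms(1) unfolding homotopy_def
proof (induction rule: rtrancl_induct)
  case base
  show ?case using assms(3) by (auto simp: equiv_def refl_on_def)
next
  case (step y z)
  have y: "is_path G y" "hd y = hd xs" "last y = last xs"
    using homotopy_path[of xs y G] step(1) assms(2) unfolding homotopy_def by blast+
  have z: "is_path G z" "hd z = hd xs" "last z = last xs"
    using homotopy_path[of xs z G] step(1,2) assms(2) unfolding homotopy_def 
    by (meson rtrancl.rtrancl_into_rtrancl)+
  have *: "(f a, f b) \<in> r" if ab: "(a, b) \<in> cycle_insertion G" "is_path G a" "hd a = hd xs" "last a = last xs" for a b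
  proof -
    obtain u x v c where *: "a = u @ x # v" "b = u @ c @ v" "c \<in> cycles_at G x" "path_length c \<in> {2, 3}"
      using ab(1) unfolding cycle_insertion_def mem_Collect_eq prod.inject append_Cons append_Nil by blast
    show ?thesis using that assms(4) * by blast
  qed
  have "(f y, f z) \<in> r \<or> (f z, f y) \<in> r" using *[of y z] *[of z y] y z step(2) by blast
  then have "(f y, f z) \<in> r" using assms(3) by (meson equivE symD)
  with step(3) show ?case using assms(3) by (meson equivE transD)
qed

lemma homotopy_append_left:
  assumes "(xs, xs') \<in> homotopy G" "is_path G xs" "is_path G ys" "last xs = hd ys"
  shows "(xs @ tl ys, xs' @ tl ys) \<in> homotopy G"
proof (rule homotopy_map[where f = "\<lambda>xs. xs @ tl ys", OF assms(1,2) equiv_homotopy])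
  fix u x v c
  assume *: "is_path G (u @ x # v)" "last (u @ x # v) = last xs" "c \<in> cycles_at G x" "path_length c \<in> {2, 3}"
  have "is_path G (u @ [x] @ (v @ tl ys))"
    using is_path_append[OF *(1) assms(3)] *(2) assms(4) by simp
  from insertion_homotopy[OF this *(3,4)] 
  show "((u @ x # v) @ tl ys, (u @ c @ v) @ tl ys) \<in> homotopy G" by simp
qed

lemma homotopy_append_right:
  assumes "(ys, ys') \<in> homotopy G" "is_path G ys" "is_path G xs" "last xs = hd ys"
  shows "(xs @ tl ys, xs @ tl ys') \<in> homotopy G"
proof (rule homotopy_map[where f = "\<lambda>ys. xs @ tl ys", OF assms(1,2) equiv_homotopy])
  fix u x v c
  assume *: "is_path G (u @ x # v)" "hd (u @ x # v) = hd ys" "c \<in> cycles_at G x" "path_length c \<in> {2, 3}"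
  have p: "is_path G (xs @ tl (u @ x # v))"
    using is_path_append[OF assms(3) *(1)] *(2) assms(4) by simp
  \<comment> \<open>If the cycle is inserted at the very first object of \<open>ys\<close>, the concatenation drops that object
    and the cycle has to be spliced in at the last object of \<open>xs\<close> instead.\<close>
  show "(xs @ tl (u @ x # v), xs @ tl (u @ c @ v)) \<in> homotopy G"
  proof (cases u)
    case Nil
    then have "last xs = x" using * assms(4) by simp
    then have xs: "xs = butlast xs @ [x]" using assms(3) path_nonempty by (metis append_butlast_last_id)
    obtain c' where c': "c = x # c'"
      using *(3) by (cases c) (auto simp: cycles_at_def is_path_def)
    have "is_path G (butlast xs @ [x] @ v)" using p Nil xs by (metis append.assoc append_Nil list.sel(3))
    from insertion_homotopy[OF this *(3,4)] 
    have "((butlast xs @ [x]) @ v, (butlast xs @ [x]) @ c' @ v) \<in> homotopy G" using c' by simp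
    then show ?thesis using Nil c' xs by simp
  next
    case (Cons z u')
    then have "is_path G ((xs @ u') @ [x] @ v)" using p by simp
    from insertion_homotopy[OF this *(3,4)] show ?thesis using Cons by simp
  qed
qed


lemma homotopy_append_middle:
  assumes "(ys, ys') \<in> homotopy G" "is_path G xs" "is_path G ys" "is_path G zs"
    and "last xs = hd ys" "last ys = hd zs"
  shows "(xs @ tl ys @ tl zs, xs @ tl ys' @ tl zs) \<in> homotopy G"
proof -
  have ys': "is_path G ys'" "hd ys' = hd ys" "last ys' = last ys"
    using homotopy_path[OF assms(1)] assms(3) by auto
  have "(ys @ tl zs, ys' @ tl zs) \<in> homotopy G"
    by (rule homotopy_append_left) (use assms in auto)
  then have "(xs @ tl (ys @ tl zs), xs @ tl (ys' @ tl zs)) \<in> homotopy G"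
    by (rule homotopy_append_right)
      (use assms path_nonempty[OF assms(3)] in \<open>auto intro: is_path_append\<close>)
  then show ?thesis using path_nonempty[OF assms(3)] path_nonempty[OF ys'(1)] by simp
qed

section \<open>The fundamental group\<close>

locale incidence_geometry =
  fixes G :: "('o, 't, 'm) geometry_scheme"
  assumes incident_refl: "incident G U U"
    and incident_sym: "incident G U W \<Longrightarrow> incident G W U"
begin

lemma is_path_rev: "is_path G xs \<Longrightarrow> is_path G (rev xs)"
proof -
  have "(\<lambda>x y. y \<noteq> x \<and> incident G y x) = (\<lambda>x y. x \<noteq> y \<and> incident G x y)"
    using incident_sym by (intro ext) blast
  then show "is_path G xs \<Longrightarrow> is_path G (rev xs)"
    by (simp only: is_path_def successively_rev set_rev rev_is_Nil_conv simp_thms)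
qed

text \<open>The last edge of \<open>xs\<close> and its reverse meet in the middle of the concatenation and
form a cycle of length 2, so the path can be shortened from its end.\<close>
lemma rev_cancel:
  assumes "is_path G xs"
  shows "(xs @ tl (rev xs), [hd xs]) \<in> homotopy G"
  using assms
proof (induction xs rule: rev_induct)
  case Nil
  then show ?case by (simp add: is_path_def)
next
  case (snoc z xs)
  show ?case
  proof (cases "xs = []")
    case True
    then show ?thesis by simp
  next
    case False
    then obtain us w where xs: "xs = us @ [w]" by (metis rev_exhaust)
    have p: "is_path G xs" and wz: "w \<in> objects G" "z \<in> objects G" "w \<noteq> z" "incident G w z"
      using snoc(2) by (auto simp: is_path_def xs successively_append_iff)
    then have "[w, z, w] \<in> cycles_at G w" "path_length [w, z, w] \<in> {2, 3}"
      using incident_sym[OF wz(4)] by (auto simp: cycles_at_def is_path_def path_length_def)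
    moreover have "is_path G (us @ [w] @ rev us)"
      using is_path_append[OF p is_path_rev[OF p]] xs by (simp)
    ultimately have "(us @ [w] @ rev us, us @ [w, z, w] @ rev us) \<in> homotopy G"
      by (intro insertion_homotopy)
    then have "(xs @ [z] @ tl (rev (xs @ [z])), xs @ tl (rev xs)) \<in> homotopy G"
      using xs homotopy_sym by auto
    from homotopy_trans[OF this snoc.IH[OF p]] show ?thesis using False by simp
  qed
qed

abbreviation hclass :: "'o list \<Rightarrow> 'o list set" where
  "hclass xs \<equiv> homotopy G `` {xs}"

lemma hclass_eqI: "(xs, ys) \<in> homotopy G \<Longrightarrow> hclass xs = hclass ys"
  by (rule equiv_class_eq[OF equiv_homotopy])

lemma hclass_eq_iff: "hclass xs = hclass ys \<longleftrightarrow> (xs, ys) \<in> homotopy G"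
  using eq_equiv_class_iff[OF equiv_homotopy] by simp

lemma carrier_fundamental_group: "carrier (fundamental_group G x) = hclass ` cycles_at G x"
  by (auto simp: fundamental_group_def quotient_def)

lemma one_fundamental_group: "\<one>\<^bsub>fundamental_group G x\<^esub> = hclass [x]"
  by (simp add: fundamental_group_def)

lemma cycle_append:
  assumes "c \<in> cycles_at G x" "d \<in> cycles_at G x"
  shows "c @ tl d \<in> cycles_at G x"
proof -
  have *: "is_path G c" "is_path G d" "hd c = x" "last c = hd d" "last d = x" "c \<noteq> []" "d \<noteq> []"
    using assms path_nonempty by (auto simp: cycles_at_def)
  show ?thesis
    using is_path_append[OF *(1,2,4)] last_append_tl[OF *(6,7,4)] *(3,5,6) by (simp add: cycles_at_def)
qed

text \<open>Concatenation respects homotopy, so all the classes in the union that defines the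
product are the same one.\<close>
lemma mult_fundamental_group:
  assumes "c \<in> cycles_at G x" "d \<in> cycles_at G x"
  shows "hclass c \<otimes>\<^bsub>fundamental_group G x\<^esub> hclass d = hclass (c @ tl d)"
proof -
  have c: "is_path G c" "last c = x" and d: "is_path G d" "hd d = x"
    using assms by (auto simp: cycles_at_def)
  have "hclass (c' @ tl d') = hclass (c @ tl d)" if "(c, c') \<in> homotopy G" "(d, d') \<in> homotopy G" for c' d'
  proof -
    have c': "is_path G c'" "last c' = x" using homotopy_path[OF that(1)] c by simp_all
    have "(c @ tl d, c' @ tl d) \<in> homotopy G"
      by (rule homotopy_append_left[OF that(1) c(1) d(1)]) (simp add: c d)
    moreover have "(c' @ tl d, c' @ tl d') \<in> homotopy G"
      by (rule homotopy_append_right[OF that(2) d(1) c'(1)]) (simp add: c' d)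
    ultimately show ?thesis by (rule hclass_eqI[OF homotopy_trans, symmetric])
  qed
  note eq = this
  have "(\<Union>c'\<in>hclass c. \<Union>d'\<in>hclass d. hclass (c' @ tl d')) =
      (\<Union>c'\<in>hclass c. \<Union>d'\<in>hclass d. hclass (c @ tl d))"
    by (intro SUP_cong refl eq) auto
  also have "\<dots> = hclass (c @ tl d)"
    using homotopy_refl[of c G] homotopy_refl[of d G] by blast
  finally show ?thesis unfolding fundamental_group_def by simp
qed

lemma trivial_cycle: "x \<in> objects G \<Longrightarrow> [x] \<in> cycles_at G x"
  by (simp add: cycles_at_def is_path_def)

lemma group_fundamental_group:
  assumes "x \<in> objects G"
  shows "group (fundamental_group G x)"
proof (rule groupI, goal_cases)
  case (1 a b)
  then show ?case
    using mult_fundamental_group cycle_append by (auto simp: carrier_fundamental_group)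
next
  case 2
  then show ?case
    using trivial_cycle[OF assms] by (auto simp: carrier_fundamental_group one_fundamental_group)
next
  case (3 a b c)
  then obtain xs ys zs where *: "xs \<in> cycles_at G x" "a = hclass xs" "ys \<in> cycles_at G x" "b = hclass ys"
    "zs \<in> cycles_at G x" "c = hclass zs"
    by (auto simp: carrier_fundamental_group)
  have "ys \<noteq> []" using * path_nonempty by (auto simp: cycles_at_def)
  with * show ?case by (simp add: mult_fundamental_group cycle_append)
next
  case (4 a)
  then obtain xs where *: "xs \<in> cycles_at G x" "a = hclass xs"
    by (auto simp: carrier_fundamental_group)
  then have "x # tl xs = xs" by (cases xs) (auto simp: cycles_at_def is_path_def)
  with * show ?case by (simp add: one_fundamental_group mult_fundamental_group trivial_cycle assms)
next
  case (5 a)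
  then obtain xs where *: "xs \<in> cycles_at G x" "a = hclass xs"
    by (auto simp: carrier_fundamental_group)
  have p: "is_path G xs" "hd xs = x" "last xs = x" using * by (auto simp: cycles_at_def)
  have r: "rev xs \<in> cycles_at G x"
    using p is_path_rev path_nonempty[of G xs] by (auto simp: cycles_at_def hd_rev last_rev)
  have "(rev xs @ tl xs, [x]) \<in> homotopy G"
    using rev_cancel[OF is_path_rev[OF p(1)]] p path_nonempty[of G xs] by (auto simp: hd_rev)
  then have "hclass (rev xs) \<otimes>\<^bsub>fundamental_group G x\<^esub> a = \<one>\<^bsub>fundamental_group G x\<^esub>"
    using * r by (simp add: one_fundamental_group mult_fundamental_group hclass_eqI)
  then show ?case using r by (auto simp: carrier_fundamental_group)
qed

end

section \<open>Edge cocycles\<close>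

fun path_product :: "('g, 'n) monoid_scheme \<Rightarrow> ('o \<Rightarrow> 'o \<Rightarrow> 'g) \<Rightarrow> 'o list \<Rightarrow> 'g" where
  "path_product \<G> g (U # W # xs) = g U W \<otimes>\<^bsub>\<G>\<^esub> path_product \<G> g (W # xs)"
| "path_product \<G> g _ = \<one>\<^bsub>\<G>\<^esub>"

context incidence_geometry
begin

text \<open>Both paths become \<open>[U, W, X, U, X]\<close> after one insertion: a triangle at \<open>U\<close> on one side,
a cycle of length 2 at \<open>X\<close> on the other.\<close>
lemma triangle_homotopy:
  assumes "{U, W, X} \<subseteq> objects G" "incident G U W" "incident G W X" "incident G U X" 
    and "U \<noteq> W" "W \<noteq> X" "U \<noteq> X"
  shows "([U, W, X], [U, X]) \<in> homotopy G"
proof -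
  note sym = assms(2-4)[THEN incident_sym]
  have "([] @ [U] @ [X], [] @ [U, W, X, U] @ [X]) \<in> homotopy G"
    by (rule insertion_homotopy)
      (use assms sym in \<open>auto simp: is_path_def cycles_at_def path_length_def\<close>)
  moreover have "([U, W] @ [X] @ [], [U, W] @ [X, U, X] @ []) \<in> homotopy G"
    by (rule insertion_homotopy)
      (use assms sym in \<open>auto simp: is_path_def cycles_at_def path_length_def\<close>)
  ultimately have "([U, X], [U, W, X, U, X]) \<in> homotopy G" "([U, W, X], [U, W, X, U, X]) \<in> homotopy G"
    by simp_all
  then show ?thesis by (rule homotopy_trans[OF _ homotopy_sym, rotated])
qed

text \<open>Fix a path \<open>P U\<close> from \<open>x\<close> to every object \<open>U\<close> and assign to an edge the class of the cycle
that runs along \<open>P U\<close>, the edge and then back along \<open>P W\<close>. In the product along a cycle the connecting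
paths cancel, so the product is the class of the cycle. This turns statements about the fundamental group into
algebra with a group-valued cocycle.\<close>
lemma edge_cocycle:
  assumes "connected_geometry G" "x \<in> objects G"
  obtains g where
    "\<And>U W. U \<in> objects G \<Longrightarrow> W \<in> objects G \<Longrightarrow> incident G U W \<Longrightarrow> g U W \<in> carrier (fundamental_group G x)"
    "\<And>U W X. {U, W, X} \<subseteq> objects G \<Longrightarrow> incident G U W \<Longrightarrow> incident G W X \<Longrightarrow> incident G U X \<Longrightarrow>
       g U W \<otimes>\<^bsub>fundamental_group G x\<^esub> g W X = g U X"
    "\<And>c. c \<in> cycles_at G x \<Longrightarrow> hclass c = path_product (fundamental_group G x) g c"
proof -
  let ?F = "fundamental_group G x"
  have "\<exists>xs. is_path G xs \<and> hd xs = x \<and> last xs = U \<and> (U = x \<longrightarrow> xs = [x])" if "U \<in> objects G" for U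
    using that assms trivial_cycle[OF assms(2)] unfolding connected_geometry_def cycles_at_def
    by (cases "U = x") auto
  then obtain P where P: "\<And>U. U \<in> objects G \<Longrightarrow> is_path G (P U) \<and> hd (P U) = x \<and> last (P U) = U"
    "P x = [x]"
    using assms(2) by metis
  define conj where "conj xs = P (hd xs) @ tl xs @ tl (rev (P (last xs)))" for xs
  \<comment> \<open>Paths have no repeated consecutive objects, so a degenerate edge becomes a path of length 0.\<close>
  define link where "link U W = (if U = W then [U] else [U, W])" for U W :: 'o
  have ends: "hd xs \<in> objects G" "last xs \<in> objects G" if "is_path G xs" for xs
    using that by (auto simp: is_path_def)
  have revP: "is_path G (rev (P U))" "hd (rev (P U)) = U" "last (rev (P U)) = x" if "U \<in> objects G" for U
    using P(1)[OF that] is_path_rev path_nonempty by (auto simp: hd_rev last_rev)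
  have conj_cycle: "conj xs \<in> cycles_at G x" if "is_path G xs" for xs
  proof -
    let ?A = "P (hd xs)" and ?B = "rev (P (last xs))"
    note A = P(1)[OF ends(1)[OF that]] and B = revP[OF ends(2)[OF that]]
    have ne: "xs \<noteq> []" "?A \<noteq> []" "?B \<noteq> []" using that A B path_nonempty by blast+
    have 1: "is_path G (xs @ tl ?B)" "last (xs @ tl ?B) = x" "hd (xs @ tl ?B) = hd xs"
      using is_path_append[OF that B(1)] last_append_tl[of xs ?B] B ne by auto
    have "is_path G (?A @ tl (xs @ tl ?B))" "last (?A @ tl (xs @ tl ?B)) = x"
      using is_path_append[of G ?A "xs @ tl ?B"] last_append_tl[of ?A "xs @ tl ?B"] A 1 ne by auto
    then show ?thesis using ne A by (simp add: cycles_at_def conj_def)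
  qed
  have conj_hom: "hclass (conj xs) = hclass (conj ys)" if "(xs, ys) \<in> homotopy G" "is_path G xs" for xs ys
    unfolding conj_def using homotopy_path[OF that(1)] that P(1)[OF ends(1)[OF that(2)]] revP[OF ends(2)[OF that(2)]]
    by (intro hclass_eqI) (auto intro!: homotopy_append_middle)
  have conj_mult: "hclass (conj xs) \<otimes>\<^bsub>?F\<^esub> hclass (conj ys) = hclass (conj (xs @ tl ys))"
    if "is_path G xs" "is_path G ys" "last xs = hd ys" for xs ys
  proof -
    let ?A = "P (hd xs)" and ?B = "P (last xs)" and ?C = "rev (P (last ys))"
    note A = P(1)[OF ends(1)[OF that(1)]] and B = P(1)[OF ends(2)[OF that(1)]] and C = revP[OF ends(2)[OF that(2)]]
     and B' = revP[OF ends(2)[OF that(1)]]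
    have ne: "xs \<noteq> []" "ys \<noteq> []" "?A \<noteq> []" "?C \<noteq> []" "?B \<noteq> []" using that A B C path_nonempty by blast+
    have "(rev ?B @ tl ?B, [last xs]) \<in> homotopy G"
      using rev_cancel[OF B'(1)] B'(2) by simp
    moreover have "is_path G (rev ?B @ tl ?B)" "hd (rev ?B @ tl ?B) = last xs" "last (rev ?B @ tl ?B) = last xs"
      using is_path_append[OF B'(1), of ?B] last_append_tl[of "rev ?B" ?B] B B' ne by auto
    moreover have 1: "is_path G (?A @ tl xs)" "last (?A @ tl xs) = last xs"
      using is_path_append[of G ?A xs] last_append_tl[of ?A xs] A that ne by auto
    moreover have 2: "is_path G (ys @ tl ?C)" "hd (ys @ tl ?C) = last xs"
      using is_path_append[of G ys ?C] C that ne by auto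
    ultimately have "((?A @ tl xs) @ tl (rev ?B @ tl ?B) @ tl (ys @ tl ?C),
       (?A @ tl xs) @ tl [last xs] @ tl (ys @ tl ?C)) \<in> homotopy G"
      by (intro homotopy_append_middle) auto
    moreover have "conj (xs @ tl ys) = (?A @ tl xs) @ tl [last xs] @ tl (ys @ tl ?C)"
      using ne last_append_tl[OF ne(1,2) that(3)] by (simp add: conj_def)
    moreover have "conj xs @ tl (conj ys) = (?A @ tl xs) @ tl (rev ?B @ tl ?B) @ tl (ys @ tl ?C)"
      using ne that(3) by (simp add: conj_def)
    ultimately show ?thesis
      using mult_fundamental_group[OF conj_cycle[OF that(1)] conj_cycle[OF that(2)]] hclass_eqI by metis
  qed
  have conj_one: "hclass (conj [U]) = \<one>\<^bsub>?F\<^esub>" if "U \<in> objects G" for U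
    using rev_cancel[of "P U"] P(1)[OF that] by (simp add: conj_def one_fundamental_group hclass_eqI)
  define g where "g U W = hclass (conj (link U W))" for U W
  have link_path: "is_path G (link U W)" "hd (link U W) = U" "last (link U W) = W" 
    if "U \<in> objects G" "W \<in> objects G" "incident G U W" for U W
    using that by (auto simp: link_def is_path_def)
  have product: "hclass (conj xs) = path_product ?F g xs" if "is_path G xs" for xs
    using that
  proof (induction xs rule: induct_list012)
    case 1
    then show ?case by (simp add: is_path_def)
  next
    case (2 U)
    then show ?case using conj_one by (simp add: is_path_def)
  next
    case (3 U W xs)
    then have UW: "is_path G [U, W]" "is_path G (W # xs)" "U \<noteq> W" by (auto simp: is_path_def)
    have "hclass (conj (U # W # xs)) = hclass (conj [U, W]) \<otimes>\<^bsub>?F\<^esub> hclass (conj (W # xs))"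
      using conj_mult[OF UW(1,2)] by simp
    also have "hclass (conj (W # xs)) = path_product ?F g (W # xs)"
      using 3 UW by blast
    finally have "hclass (conj (U # W # xs)) = hclass (conj [U, W]) \<otimes>\<^bsub>?F\<^esub> path_product ?F g (W # xs)" .
    moreover have "hclass (conj [U, W]) = g U W" using UW(3) by (simp add: g_def link_def)
    ultimately show ?case by simp
  qed
  show ?thesis
  proof (rule that[of g])
    fix U W assume "U \<in> objects G" "W \<in> objects G" "incident G U W"
    then show "g U W \<in> carrier ?F"
      using conj_cycle[OF link_path(1)[of U W]] unfolding g_def carrier_fundamental_group by blast
  next
    fix U W X assume *: "{U, W, X} \<subseteq> objects G" "incident G U W" "incident G W X" "incident G U X"
    have "(link U W @ tl (link W X), link U X) \<in> homotopy G"
    proof (cases "U = W \<or> W = X")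
      case True
      then show ?thesis by (auto simp: link_def)
    next
      case False
      then have UWX: "U \<noteq> W" "W \<noteq> X" by auto
      show ?thesis
      proof (cases "U = X")
        case True
        then show ?thesis
          using rev_cancel[OF link_path(1)[of U W]] * UWX by (auto simp: link_def)
      next
        case neq: False
        then show ?thesis using triangle_homotopy[OF *] UWX by (auto simp: link_def)
      qed
    qed
    moreover have "is_path G (link U W @ tl (link W X))"
      using is_path_append[of G "link U W" "link W X"] link_path[of U W] link_path[of W X] * by simp
    moreover have "g U W \<otimes>\<^bsub>?F\<^esub> g W X = hclass (conj (link U W @ tl (link W X)))"
      using conj_mult[of "link U W" "link W X"] link_path[of U W] link_path[of W X] * by (simp add: g_def)
    ultimately show "g U W \<otimes>\<^bsub>?F\<^esub> g W X = g U X"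
      using conj_hom[of "link U W @ tl (link W X)" "link U X"] unfolding g_def by simp
  next
    fix c assume "c \<in> cycles_at G x"
    then have "is_path G c" "hd c = x" "last c = x" "c \<noteq> []" by (auto simp: cycles_at_def is_path_def)
    then show "hclass c = path_product ?F g c"
      using product[of c] by (cases c) (auto simp: conj_def P(2))
  qed
qed

end

lemma path_product_append:
  fixes \<G> (structure)
  assumes "group \<G>" "\<And>U W. g U W \<in> carrier \<G>"
  shows "path_product \<G> g (u @ x # v) = path_product \<G> g (u @ [x]) \<otimes>\<^bsub>\<G>\<^esub> path_product \<G> g (x # v)"
    and "path_product \<G> g xs \<in> carrier \<G>"
proof -
  interpret group \<G> by fact
  have closed: "path_product \<G> g xs \<in> carrier \<G>" for xs
    by (induction xs rule: induct_list012) (simp_all add: assms(2))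
  show "path_product \<G> g (u @ x # v) = path_product \<G> g (u @ [x]) \<otimes> path_product \<G> g (x # v)"
  proof (induction u rule: induct_list012)
    case (3 a b u)
    then show ?case by (simp add: m_assoc assms(2) closed)
  qed (simp_all add: assms(2) closed)
  show "path_product \<G> g xs \<in> carrier \<G>" by (rule closed)
qed

context incidence_geometry
begin

text \<open>The cocycle condition makes the product along a cycle of length 2 or 3 trivial.\<close>
lemma path_product_homotopic:
  assumes "group \<G>" and closed: "\<And>U W. g U W \<in> carrier \<G>"
    and cocycle: "\<And>U W X. {U, W, X} \<subseteq> objects G \<Longrightarrow> incident G U W \<Longrightarrow> incident G W X \<Longrightarrow> incident G U X \<Longrightarrow>
       g U W \<otimes>\<^bsub>\<G>\<^esub> g W X = g U X"
    and "(xs, ys) \<in> homotopy G" "is_path G xs"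
  shows "path_product \<G> g xs = path_product \<G> g ys"
proof -
  interpret group \<G> by fact
  have g_refl: "g U U = \<one>\<^bsub>\<G>\<^esub>" if "U \<in> objects G" for U
    using cocycle[of U U U] that incident_refl[of U] closed[of U U] r_cancel_one by force
  have short: "path_product \<G> g c = \<one>\<^bsub>\<G>\<^esub>" if c: "c \<in> cycles_at G x" "path_length c \<in> {2, 3}" for c x
  proof -
    have "length c = 3 \<or> length c = 4" using c(2) by (auto simp: path_length_def)
    then consider y z where "c = [x, y, z]" "z = x" | y w z where "c = [x, y, w, z]" "z = x"
      using c(1) by (auto simp: cycles_at_def length_Suc_conv numeral_eq_Suc)
    then show ?thesis
    proof cases
      case (1 y z)
      then show ?thesis using c cocycle[of x y x] g_refl[of x] incident_refl incident_sym closed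
        by (auto simp: cycles_at_def is_path_def)
    next
      case (2 y w z)
      then have i: "{x, y, w} \<subseteq> objects G" "incident G x y" "incident G y w" "incident G w x"
        using c by (auto simp: cycles_at_def is_path_def)
      have "g y w \<otimes>\<^bsub>\<G>\<^esub> g w x = g y x" "g x y \<otimes>\<^bsub>\<G>\<^esub> g y x = \<one>\<^bsub>\<G>\<^esub>"
        using cocycle[of y w x] cocycle[of x y x] i incident_sym incident_refl g_refl by auto
      then show ?thesis using 2 closed by simp
    qed
  qed
  have "equiv UNIV Id" by (simp add: equiv_def refl_Id sym_Id trans_Id)
  from assms(4,5) this have "(path_product \<G> g xs, path_product \<G> g ys) \<in> Id"
  proof (rule homotopy_map)
    fix u x v c assume *: "c \<in> cycles_at G x" "path_length c \<in> {2, 3}"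
    note app = path_product_append[where g = g, OF assms(1) closed]
    obtain c' where c': "c = x # c'"
      using *(1) by (cases c) (auto simp: cycles_at_def is_path_def)
    obtain c'' where c'': "c = c'' @ [x]"
      using *(1) by (cases c rule: rev_cases) (auto simp: cycles_at_def is_path_def)
    have "path_product \<G> g (u @ c @ v) = path_product \<G> g (u @ [x]) \<otimes>\<^bsub>\<G>\<^esub> path_product \<G> g (c @ v)"
      using app(1)[of u x "c' @ v"] c' by simp
    also have "path_product \<G> g (c @ v) = path_product \<G> g c \<otimes>\<^bsub>\<G>\<^esub> path_product \<G> g (x # v)"
      using app(1)[of c'' x v] c'' by simp
    finally show "(path_product \<G> g (u @ x # v), path_product \<G> g (u @ c @ v)) \<in> Id"
      using short[OF *] app(1)[of u x v] app(2) by simp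
  qed
  then show ?thesis by simp
qed

end

text \<open>If an edge cocycle is cohomologous to one with values in \<open>{\<one>, t}\<close>, the factors \<open>h\<close> cancel
along a path except at its two ends.\<close>
lemma path_product_gauge:
  fixes \<G> (structure)
  assumes "group \<G>" "is_path G xs" and t: "t \<in> carrier \<G>" "t \<otimes> t = \<one>"
    and h: "\<And>U. U \<in> objects G \<Longrightarrow> h U \<in> carrier \<G>"
    and g: "\<And>U W. U \<in> objects G \<Longrightarrow> W \<in> objects G \<Longrightarrow> incident G U W \<Longrightarrow>
       g U W \<in> carrier \<G> \<and> h U \<otimes> g U W \<otimes> inv (h W) \<in> {\<one>, t}"
  shows "path_product \<G> g xs \<in> carrier \<G> \<and> h (hd xs) \<otimes> path_product \<G> g xs \<otimes> inv (h (last xs)) \<in> {\<one>, t}"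
  using assms(2)
proof (induction xs rule: induct_list012)
  case 1
  then show ?case by (simp add: is_path_def)
next
  case (2 U)
  interpret group \<G> by fact
  from 2 show ?case using h by (simp add: is_path_def)
next
  case (3 U W xs)
  interpret group \<G> by fact
  let ?p = "path_product \<G> g (W # xs)" and ?l = "last (W # xs)"
  have o: "U \<in> objects G" "W \<in> objects G" "?l \<in> objects G" "incident G U W" "is_path G (W # xs)"
    using 3(3) by (auto simp: is_path_def)
  note p = 3(2)[OF o(5)] and gU = g[OF o(1,2,4)]
  have "h U \<otimes> (g U W \<otimes> ?p) \<otimes> inv (h ?l) = (h U \<otimes> g U W \<otimes> inv (h W)) \<otimes> (h W \<otimes> ?p \<otimes> inv (h ?l))"
  proof -
    have "inv (h W) \<otimes> (h W \<otimes> x) = x" if "x \<in> carrier \<G>" for x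
      using that h[OF o(2)] by (simp add: m_assoc[symmetric])
    then show ?thesis using h o(1-3) p gU by (simp add: m_assoc)
  qed
  then show ?case using p gU t by auto
qed

context group
begin

lemma order_2_iso_integer_mod_group:
  assumes "carrier G = {\<one>, t}" "t \<noteq> \<one>"
  shows "G \<cong> integer_mod_group 2"
proof -
  have tt: "t \<otimes> t = \<one>"
  proof (rule ccontr)
    assume "t \<otimes> t \<noteq> \<one>"
    then have "t \<otimes> t = t" using m_closed[of t t] assms(1) by auto
    then show False using assms r_cancel_one[of t t] by simp
  qed
  define f where "f a = (if a = \<one> then 0 else 1 :: int)" for a
  have "f \<in> hom G (integer_mod_group 2)"
    using assms tt by (auto simp: hom_def f_def carrier_integer_mod_group)
  moreover have "bij_betw f (carrier G) (carrier (integer_mod_group 2))"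
    using assms by (auto simp: bij_betw_def inj_on_def f_def carrier_integer_mod_group image_def)
  ultimately show ?thesis by (auto simp: is_iso_def iso_def)
qed

end

definition additive_group :: "'a::ab_group_add monoid" where
  "additive_group = \<lparr>carrier = UNIV, mult = (+), one = 0\<rparr>"

lemma additive_group_simps [simp]:
  "carrier additive_group = UNIV" "x \<otimes>\<^bsub>additive_group\<^esub> y = x + y" "\<one>\<^bsub>additive_group\<^esub> = 0"
  by (simp_all add: additive_group_def)

lemma group_additive_group: "group additive_group"
proof (rule groupI, goal_cases)
  case (5 x)
  show ?case by (rule bexI[of _ "- x"]) auto
qed (auto simp: add.assoc)

section \<open>Symplectic spaces over the field with two elements\<close>

text \<open>The hypotheses on \<open>p\<close> and \<open>H\<close> in terms of the only non-zero vector \<open>p0\<close> of \<open>p\<close>.\<close>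
locale hyperplane_complement = symplectic_space scale form
  for scale :: "'f::field \<Rightarrow> 'v::ab_group_add \<Rightarrow> 'v" (infixr \<open>*s\<close> 75)
    and form :: "'v \<Rightarrow> 'v \<Rightarrow> 'f" +
  fixes p0 :: 'v and H :: "'v set"
  assumes card_field: "CARD('f) = 2"
    and dim_space: "dim (UNIV :: 'v set) = 6"
    and p0_nonzero: "p0 \<noteq> 0"
    and subspace_H: "subspace H"
    and p0_notin_H: "p0 \<notin> H"
    and H_cover: "x \<in> H \<or> p0 + x \<in> H"
begin

lemma field_UNIV: "(UNIV :: 'f set) = {0, 1}"
proof (rule sym, rule card_subset_eq)
  show "finite (UNIV :: 'f set)" using card_field by (metis card.infinite zero_neq_numeral)
qed (use card_field in auto)

lemma field_cases: "(a :: 'f) = 0 \<or> a = 1"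
  using field_UNIV by auto

lemma neq_0_iff [simp]: "(a :: 'f) \<noteq> 0 \<longleftrightarrow> a = 1"
  using field_cases[of a] by auto

lemma field_double [simp]: "(a :: 'f) + a = 0" "a + (a + b) = b"
proof -
  have "(1 :: 'f) + 1 = 0" using field_cases[of "1 + 1"] by (metis add_cancel_right_right zero_neq_one)
  then show "a + a = 0" for a :: 'f using field_cases[of a] by auto
  then show "a + (a + b) = b" by (metis add.assoc add_0)
qed

lemma vec_double [simp]: "(x :: 'v) + x = 0" "x + (x + y) = y"
proof -
  have *: "x + x = 0" for x :: 'v
  proof -
    have "x + x = (1 + 1) *s x" by (simp only: scale_left_distrib scale_one)
    then show ?thesis by simp
  qed
  show "x + x = 0" by (rule *)
  show "x + (x + y) = y" by (metis * add.assoc add_0)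
qed

lemma vec_minus [simp]: "- (x :: 'v) = x" "x - y = x + y"
proof -
  show *: "- x = x" for x :: 'v by (rule minus_unique) simp
  show "x - y = x + y" using *[of y] by (metis diff_conv_add_uminus)
qed

lemma vec_add_eq_0 [simp]: "(x :: 'v) + y = 0 \<longleftrightarrow> x = y"
  using vec_minus(2) by (metis right_minus_eq)

lemma form_add_left [simp]: "form (u + v) w = form u w + form v w"
proof -
  interpret l: Vector_Spaces.linear scale "(*)" "\<lambda>u. form u w" by (rule form_linear_left)
  show ?thesis by (rule l.add)
qed

lemma form_add_right [simp]: "form w (u + v) = form w u + form w v"
proof -
  interpret l: Vector_Spaces.linear scale "(*)" "\<lambda>u. form w u" by (rule form_linear_right)
  show ?thesis by (rule l.add)
qed

lemma form_zero [simp]: "form 0 v = 0" "form v 0 = 0"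
  using form_add_left[of 0 0 v] form_add_right[of v 0 0] by auto

lemma form_self [simp]: "form v v = 0"
  by (rule form_alternating)

lemma form_commute: "form u v = form v u"
proof -
  have "form (u + v) (u + v) = 0" by (rule form_self)
  then have "form u v + form v u = 0"
    unfolding form_add_left form_add_right by (simp add: add.commute)
  then show ?thesis by (metis add.right_neutral field_double(2))
qed

lemma subspace_iff: "subspace U \<longleftrightarrow> 0 \<in> U \<and> (\<forall>x\<in>U. \<forall>y\<in>U. x + y \<in> U)"
proof -
  have "c *s x \<in> U" if "0 \<in> U" "x \<in> U" for c x using field_cases[of c] that by auto
  then show ?thesis unfolding subspace_def by blast
qed

lemma subspace_0: "subspace U \<Longrightarrow> 0 \<in> U" and subspace_plus: "subspace U \<Longrightarrow> x \<in> U \<Longrightarrow> y \<in> U \<Longrightarrow> x + y \<in> U"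
  by (auto simp: subspace_iff)

lemma in_span_insert: "x \<in> span (insert a S) \<longleftrightarrow> x \<in> span S \<or> a + x \<in> span S"
proof -
  have "x \<in> span (insert a S) \<longleftrightarrow> (\<exists>k. x - k *s a \<in> span S)"
    by (rule span_breakdown_eq)
  also have "\<dots> \<longleftrightarrow> x \<in> span S \<or> a + x \<in> span S"
  proof
    assume "\<exists>k. x - k *s a \<in> span S"
    then obtain k where "x - k *s a \<in> span S" ..
    then show "x \<in> span S \<or> a + x \<in> span S"
      using field_cases[of k] by (auto simp: add.commute)
  next
    assume "x \<in> span S \<or> a + x \<in> span S"
    then have "x - 0 *s a \<in> span S \<or> x - 1 *s a \<in> span S" by (simp add: add.commute)
    then show "\<exists>k. x - k *s a \<in> span S" by blast
  qed
  finally show ?thesis .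
qed

lemma vec_solve: "(x :: 'v) + y = z \<longleftrightarrow> y = x + z"
  by auto

lemma span_1: "span {a} = {0, a}"
  by (auto simp: in_span_insert)

lemma span_2: "span {a, b} = {0, a, b, a + b}"
  unfolding set_eq_iff in_span_insert[of _ a] span_1 by (auto simp: vec_solve)

lemma span_3: "span {a, b, c} = {0, a, b, c, a + b, a + c, b + c, a + b + c}"
  unfolding set_eq_iff in_span_insert[of _ a] span_2 by (auto simp: vec_solve add.assoc)

sublocale finite_dimensional_vector_space scale "extend_basis {}"
proof
  show "independent (extend_basis {})" by (simp add: independent_extend_basis independent_empty)
  show "span (extend_basis {}) = UNIV" by (simp add: span_extend_basis independent_empty)
  have "card (extend_basis {}) = 6"
    using dim_eq_card[of "extend_basis {}" UNIV] dim_space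
    by (simp add: independent_extend_basis span_extend_basis independent_empty)
  then show "finite (extend_basis {})" by (metis card.infinite zero_neq_numeral)
qed

lemma dim_H: "dim H = 5"
proof -
  have "span (insert p0 H) = UNIV"
    using H_cover subspace_H by (auto simp: in_span_insert span_eq_iff[THEN iffD2])
  then have "dim (insert p0 H) = 6" using dim_space by (metis dim_span)
  then show ?thesis using subspace_H p0_notin_H by (simp add: dim_insert span_eq_iff[THEN iffD2])
qed

lemma dim_1: "a \<noteq> 0 \<Longrightarrow> dim {0, a} = 1"
  using dim_span[of "{a}"] by (simp add: span_1 dim_insert)

lemma dim_2: "a \<noteq> 0 \<Longrightarrow> b \<noteq> 0 \<Longrightarrow> a \<noteq> b \<Longrightarrow> dim {a, b} = 2"
  by (simp add: dim_insert span_1)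

lemma dim_3: "a \<noteq> 0 \<Longrightarrow> b \<noteq> 0 \<Longrightarrow> c \<noteq> 0 \<Longrightarrow> b \<noteq> c \<Longrightarrow> a \<noteq> b \<Longrightarrow> a \<noteq> c \<Longrightarrow> a \<noteq> b + c \<Longrightarrow> dim {a, b, c} = 3"
  using dim_2[of b c] by (simp add: dim_insert[of a] span_2)

section \<open>Points, lines, planes and hyperplanes\<close>

definition point :: "'v \<Rightarrow> bool" where
  "point a \<longleftrightarrow> a \<in> H \<and> form p0 a = 1"

text \<open>The directions of \<open>U\<close>: translations of the affine space of its points.\<close>
definition dir :: "'v set \<Rightarrow> 'v set" where
  "dir U = {x \<in> U. form p0 x = 0}"

abbreviation is_object :: "'v set \<Rightarrow> bool" where
  "is_object U \<equiv> U \<in> Pi_objects {0, p0} H"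

lemma perp_p: "perp {0, p0} = {v. form p0 v = 0}"
  by (auto simp: perp_def)

lemma Int_perp_p: "U \<inter> perp {0, p0} = dir U"
  by (auto simp: perp_p dir_def)

lemma point_nonzero: "point a \<Longrightarrow> a \<noteq> 0"
  by (auto simp: point_def)

lemma in_Rad: "x \<in> Rad U \<longleftrightarrow> x \<in> U \<and> (\<forall>u\<in>U. form x u = 0)"
  by (auto simp: Rad_def perp_def form_commute)

text \<open>Not being contained in the orthogonal space of \<open>p\<close> means containing a point.\<close>
lemma is_object_iff:
  "is_object U \<longleftrightarrow> subspace U \<and> U \<subset> H \<and> (\<exists>a\<in>U. point a) \<and> dim (Rad U) \<le> 2 \<and>
     (Rad U = {0} \<or> (\<exists>a\<in>Rad U. point a))"
proof -
  have 1: "\<not> X \<subseteq> perp {0, p0} \<longleftrightarrow> (\<exists>a\<in>X. point a)" if "X \<subseteq> H" for X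
    using that by (auto simp: perp_p point_def)
  have "Rad U \<subseteq> U" by (auto simp: in_Rad)
  then show ?thesis
    unfolding Pi_objects_def using 1[of U] 1[of "Rad U"] point_nonzero by auto
qed

lemma Rad_subset: "Rad U \<subseteq> U"
  by (simp add: Rad_def)

lemma object_subspace: "is_object U \<Longrightarrow> subspace U" and object_subset: "is_object U \<Longrightarrow> U \<subseteq> H"
  by (auto simp: is_object_iff)

lemma subspace_Rad: "subspace U \<Longrightarrow> subspace (Rad U)"
  by (auto simp: subspace_iff in_Rad)

lemma subspace_dir: "subspace U \<Longrightarrow> subspace (dir U)"
  by (auto simp: subspace_iff dir_def)

lemma point_add_dir: "is_object U \<Longrightarrow> a \<in> U \<Longrightarrow> point a \<Longrightarrow> b \<in> U \<Longrightarrow> point b \<Longrightarrow> a + b \<in> dir U"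
  using subspace_plus[OF object_subspace, of U a b] by (auto simp: dir_def point_def)

lemma dir_add_point: "is_object U \<Longrightarrow> a \<in> U \<Longrightarrow> point a \<Longrightarrow> d \<in> dir U \<Longrightarrow> a + d \<in> U \<and> point (a + d)"
  using subspace_plus[OF object_subspace, of U a d] object_subset[of U] by (auto simp: dir_def point_def)

text \<open>Every vector of \<open>U\<close> is either a direction or a point, and any two points differ by a
direction.\<close>
lemma dir_or_translate:
  assumes "subspace U" "a \<in> U" "point a"
  shows "y \<in> U \<longleftrightarrow> y \<in> dir U \<or> a + y \<in> dir U"
proof
  assume "y \<in> U"
  then show "y \<in> dir U \<or> a + y \<in> dir U"
    using assms subspace_plus[OF assms(1,2)] field_cases[of "form p0 y"] by (auto simp: dir_def point_def)
next
  have "a + (a + y) \<in> U" if "a + y \<in> U" by (rule subspace_plus[OF assms(1,2) that])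
  then show "y \<in> dir U \<or> a + y \<in> dir U \<Longrightarrow> y \<in> U" by (auto simp: dir_def)
qed

lemma dim_dir_subspace:
  assumes U: "subspace U" and a: "a \<in> U" "point a"
  shows "dim U = dim (dir U) + 1"
proof -
  have sd: "span (dir U) = dir U" using subspace_dir[OF U] by (simp add: span_eq_iff)
  have "span (insert a (dir U)) = U"
    unfolding set_eq_iff in_span_insert sd using dir_or_translate[OF U a] by blast
  then have "dim U = dim (insert a (dir U))" by (metis dim_span)
  also have "\<dots> = dim (dir U) + 1"
    using a by (simp add: dim_insert sd) (simp add: dir_def point_def)
  finally show ?thesis .
qed

lemma dim_dir: "is_object U \<Longrightarrow> dim U = dim (dir U) + 1"
  using dim_dir_subspace by (auto simp: is_object_iff)

lemma span_subset: "subspace U \<Longrightarrow> S \<subseteq> U \<Longrightarrow> span S \<subseteq> U"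
  by (rule span_minimal)

lemma dim_object: "is_object U \<Longrightarrow> 1 \<le> dim U \<and> dim U \<le> 4"
  using dim_dir[of U] dim_psubset[of U H] subspace_H dim_H
  by (auto simp: is_object_iff span_eq_iff[THEN iffD2])

lemma full_subspace:
  assumes "subspace U" "S \<subseteq> U" "dim U \<le> dim S"
  shows "U = span S"
  using subspace_dim_equal[OF subspace_span assms(1) span_subset[OF assms(1,2)]] assms(3) by simp

lemma point_object:
  assumes "point a"
  shows "is_object {0, a}" "dim {0, a} = 1"
proof -
  show d: "dim {0, a} = 1" using dim_1 point_nonzero[OF assms] by blast
  have "{0, a} \<subseteq> H" using assms subspace_H by (auto simp: point_def subspace_0)
  moreover have "{0, a} \<noteq> H" using d dim_H by auto
  moreover have "Rad {0, a} = {0, a}" by (auto simp: in_Rad)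
  moreover have "subspace {0, a}" by (auto simp: subspace_iff)
  ultimately show "is_object {0, a}" using assms d by (auto simp: is_object_iff)
qed

abbreviation line :: "'v \<Rightarrow> 'v \<Rightarrow> 'v set" where
  "line a b \<equiv> {0, a, b, a + b}"

lemma line_object:
  assumes "point a" "point b" "a \<noteq> b"
  shows "is_object (line a b)" "dim (line a b) = 2"
proof -
  have s: "subspace (line a b)" using subspace_span[of "{a, b}"] by (simp add: span_2)
  show d: "dim (line a b) = 2"
    using dim_2[of a b] dim_span[of "{a, b}"] assms point_nonzero by (simp add: span_2)
  have "line a b \<subseteq> H" using assms subspace_H by (auto simp: point_def subspace_0 subspace_plus)
  moreover have "line a b \<noteq> H" using d dim_H by auto
  moreover have "dim (Rad (line a b)) \<le> 2" using dim_subset[OF Rad_subset, of "line a b"] d by simp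
  moreover have "Rad (line a b) = {0} \<or> a \<in> Rad (line a b)"
  proof (cases "form a b = 0")
    case True
    then have "a \<in> Rad (line a b)" by (auto simp: in_Rad)
    then show ?thesis ..
  next
    case False
    then have "form a b = 1" "form b a = 1" using form_commute by auto
    then show ?thesis by (auto simp: in_Rad)
  qed
  ultimately show "is_object (line a b)" using assms s by (auto simp: is_object_iff)
qed

text \<open>A non-zero vector of the radical cannot be a direction, since the directions
\<open>{0, a + b, a + c, b + c}\<close> form a hyperbolic plane. So two non-zero vectors of the radical would differ
by a radical direction, that is by 0, and the radical is either zero or spanned by a single point.\<close>
lemma plane_object:
  assumes "point a" "point b" "point c" "form (a + b) (a + c) = 1"
  shows "is_object (span {a, b, c})" "dim (span {a, b, c}) = 3"
proof -
  let ?P = "span {a, b, c}"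
  have f: "form p0 a = 1" "form p0 b = 1" "form p0 c = 1" using assms by (auto simp: point_def)
  have ne: "a \<noteq> b" "a \<noteq> c" "b \<noteq> c" using assms(4) by (auto simp: form_commute[of c a])
  have "a \<noteq> b + c" using f by auto
  then show d: "dim ?P = 3" using dim_3[of a b c] assms(1-3) ne point_nonzero by simp
  have dirP: "x \<in> {0, a + b, a + c, b + c}" if "x \<in> ?P" "form p0 x = 0" for x
    using that f unfolding span_3 by auto
  have in_P: "a + b \<in> ?P" "a + c \<in> ?P" unfolding span_3 by auto
  have Rad_dir: "x = 0" if "x \<in> Rad ?P" "form p0 x = 0" for x
  proof -
    have x: "x \<in> {0, a + b, a + c, b + c}" using dirP that by (auto simp: in_Rad)
    have "form x (a + b) = 0" "form x (a + c) = 0" using that in_P by (auto simp: in_Rad)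
    moreover have "form (a + c) (a + b) = 1" using assms(4) form_commute by metis
    moreover have "form (b + c) (a + b) = form (a + c) (a + b)"
      by (simp add: form_commute[of b a] form_commute[of c a] form_commute[of c b] ac_simps)
    ultimately show "x = 0" using x assms(4) by auto
  qed
  have sR: "subspace (Rad ?P)" by (simp add: subspace_Rad)
  have PH: "?P \<subseteq> H" by (rule span_subset[OF subspace_H]) (use assms in \<open>auto simp: point_def\<close>)
  have Rad: "Rad ?P = {0} \<or> (\<exists>r. point r \<and> Rad ?P = {0, r})"
  proof (cases "Rad ?P = {0}")
    case False
    then obtain r where r: "r \<in> Rad ?P" "r \<noteq> 0" using subspace_0[OF sR] by auto
    then have r1: "form p0 r = 1" using Rad_dir[of r] field_cases by blast
    have "Rad ?P \<subseteq> {0, r}"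
    proof
      fix y assume y: "y \<in> Rad ?P"
      show "y \<in> {0, r}"
      proof (cases "form p0 y = 0")
        case True
        then show ?thesis using Rad_dir y by auto
      next
        case False
        then have "form p0 (r + y) = 0" using r1 by auto
        then have "r + y = 0" using Rad_dir subspace_plus[OF sR r(1) y] by blast
        then show ?thesis by auto
      qed
    qed
    moreover have "point r" using r PH r1 by (auto simp: point_def in_Rad)
    ultimately show ?thesis using r subspace_0[OF sR] by blast
  qed simp
  then have "dim (Rad ?P) \<le> 2"
  proof
    assume "Rad ?P = {0}"
    then show ?thesis using dim_insert[of 0 "{}"] by (simp add: span_zero)
  next
    assume "\<exists>r. point r \<and> Rad ?P = {0, r}"
    then show ?thesis using dim_1 point_nonzero by auto
  qed
  moreover have "?P \<noteq> H" using d dim_H by auto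
  moreover have "a \<in> ?P" by (simp add: span_3)
  ultimately show "is_object ?P" using Rad PH assms by (auto simp: is_object_iff)
qed

lemma exists_outside_span:
  assumes "dim S < dim D"
  obtains z where "z \<in> D" "z \<notin> span S"
  using assms dim_subset[of D "span S"] by auto

text \<open>This is where the radical conditions on objects enter. If the directions were totally
isotropic, a point \<open>a\<close> would be orthogonal to some non-zero direction, which would lie in the radical. The
radical would then contain a point, and a point together with the directions spans \<open>U\<close>. So all of
\<open>U\<close> would be its own radical, which is too large.\<close>
lemma dir_not_isotropic:
  assumes "is_object U" "3 \<le> dim U"
  shows "\<exists>d1\<in>dir U. \<exists>d2\<in>dir U. form d1 d2 = 1"
proof (rule ccontr)
  assume none: "\<not> ?thesis"
  then have iso: "form x y = 0" if "x \<in> dir U" "y \<in> dir U" for x y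
    using that field_cases none by blast
  obtain a where a: "a \<in> U" "point a" using assms by (auto simp: is_object_iff)
  have sU: "subspace U" and sD: "subspace (dir U)" using assms subspace_dir by (auto simp: is_object_iff)
  have "dim (dir U) \<ge> 2" using dim_dir[OF assms(1)] assms(2) by simp
  then obtain d1 where d1: "d1 \<in> dir U" "d1 \<noteq> 0"
    using exists_outside_span[of "{}" "dir U"] by auto
  obtain d2 where d2: "d2 \<in> dir U" "d2 \<noteq> 0" "d2 \<noteq> d1"
    using exists_outside_span[of "{0, d1}" "dir U"] dim_1[OF d1(2)] \<open>dim (dir U) \<ge> 2\<close>
    by (auto simp: span_2)
  have "form a d1 = 0 \<or> form a d2 = 0 \<or> form a (d1 + d2) = 0"
    using field_cases[of "form a d1"] field_cases[of "form a d2"] by auto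
  then obtain x where x: "x \<in> dir U" "x \<noteq> 0" "form a x = 0"
    using d1 d2 subspace_plus[OF sD d1(1) d2(1)] by (metis vec_add_eq_0)
  have cover: "y \<in> dir U \<or> b + y \<in> dir U" if "y \<in> U" "b \<in> U" "point b" for b y
    using that dir_or_translate[OF sU] by blast
  have xR: "x \<in> Rad U"
    unfolding in_Rad
  proof (intro conjI ballI)
    show "x \<in> U" using x by (simp add: dir_def)
    fix y assume y: "y \<in> U"
    then consider "y \<in> dir U" | "a + y \<in> dir U" using cover a by blast
    then show "form x y = 0"
    proof cases
      case 2
      then have "form x (a + y) = 0" using iso x by blast
      then show ?thesis using x by (simp add: form_commute[of x a])
    qed (use iso x in blast)
  qed
  then obtain b where b: "b \<in> Rad U" "point b" using assms x by (auto simp: is_object_iff)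
  then have bU: "b \<in> U" and bz: "form b y = 0" "form y b = 0" if "y \<in> U" for y
    using that form_commute by (auto simp: in_Rad)
  have "U \<subseteq> Rad U"
  proof
    fix y assume y: "y \<in> U"
    have "form y z = 0" if z: "z \<in> U" for z
    proof -
      have "y \<in> dir U \<or> b + y \<in> dir U" "z \<in> dir U \<or> b + z \<in> dir U" using cover y z bU b by blast+
      then have "form y z = 0 \<or> form (b + y) z = 0 \<or> form y (b + z) = 0 \<or> form (b + y) (b + z) = 0"
        using iso by blast
      then show ?thesis using bz y z by auto
    qed
    then show "y \<in> Rad U" using y by (simp add: in_Rad)
  qed
  then have "dim U \<le> dim (Rad U)" by (rule dim_subset)
  then show False using assms by (auto simp: is_object_iff)
qed

section \<open>Triangles of points in an object\<close>

text \<open>Two independent radical vectors and one more vector would span the 3-dimensional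
direction space, making it totally isotropic.\<close>
lemma dim4_radical_unique:
  assumes U: "is_object U" "dim U = 4" and x: "x \<in> Rad (dir U)" "x \<noteq> 0" and y: "y \<in> Rad (dir U)" "y \<noteq> 0"
  shows "x = y"
proof (rule ccontr)
  assume "x \<noteq> y"
  have sD: "subspace (dir U)" by (rule subspace_dir[OF object_subspace[OF U(1)]])
  have d: "dim (dir U) = 3" "dim {x, y} = 2"
    using dim_dir[OF U(1)] U(2) dim_2[OF x(2) y(2) \<open>x \<noteq> y\<close>] by auto
  then obtain z where z: "z \<in> dir U" "z \<notin> span {x, y}"
    using exists_outside_span[of "{x, y}" "dir U"] by auto
  have R: "span {x, y} \<subseteq> Rad (dir U)"
    by (rule span_subset[OF subspace_Rad[OF sD]]) (use x y in auto)
  have "dim {z, x, y} = 3" using z d by (simp add: dim_insert)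
  then have D: "dir U = span {z, x, y}"
    by (intro full_subspace[OF sD]) (use z x y d Rad_subset in auto)
  have cover: "u \<in> Rad (dir U) \<or> z + u \<in> Rad (dir U)" if "u \<in> dir U" for u
    using that R unfolding D in_span_insert[of u z] by blast
  have zz: "form z v = 0" if "v \<in> dir U" for v
    using cover[OF that] that z form_commute[of z] by (auto simp: in_Rad)
  have "form u v = 0" if "u \<in> dir U" "v \<in> dir U" for u v
    using cover[OF that(1)] zz[OF that(2)] that(2) by (auto simp: in_Rad)
  then show False using dir_not_isotropic[OF U(1)] U(2) by fastforce
qed

text \<open>An alternating form on a space of odd dimension is degenerate: subtract from a third vector its
projection to a hyperbolic plane.\<close>
lemma dim4_radical_nonzero:
  assumes U: "is_object U" "dim U = 4"
  shows "\<exists>e\<in>Rad (dir U). e \<noteq> 0"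
proof -
  have sD: "subspace (dir U)" by (rule subspace_dir[OF object_subspace[OF U(1)]])
  obtain d1 d2 where d12: "d1 \<in> dir U" "d2 \<in> dir U" "form d1 d2 = 1" "form d2 d1 = 1"
    using dir_not_isotropic[OF U(1)] U(2) form_commute by fastforce
  then have "d1 \<noteq> 0" "d2 \<noteq> 0" "d1 \<noteq> d2" by auto
  then have d: "dim (dir U) = 3" "dim {d1, d2} = 2"
    using dim_dir[OF U(1)] U(2) dim_2 by auto
  then obtain z where z: "z \<in> dir U" "z \<notin> span {d1, d2}"
    using exists_outside_span[of "{d1, d2}" "dir U"] by auto
  define e where "e = z + (form z d2 *s d1 + form z d1 *s d2)"
  have w: "form z d2 *s d1 + form z d1 *s d2 \<in> span {d1, d2}"
    by (intro span_add span_scale span_base) auto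
  have e: "form e d1 = 0" "form e d2 = 0"
    using field_cases[of "form z d1"] field_cases[of "form z d2"] d12 by (auto simp: e_def)
  have e_out: "e \<notin> span {d1, d2}"
  proof
    assume "e \<in> span {d1, d2}"
    from span_add[OF this w] have "z \<in> span {d1, d2}" by (simp add: e_def add.assoc)
    with z show False by simp
  qed
  have eD: "e \<in> dir U"
    unfolding e_def using sD d12 z by (intro subspace_add subspace_scale) auto
  have "dim {e, d1, d2} = 3" using e_out d by (simp add: dim_insert)
  then have D: "dir U = span {e, d1, d2}"
    by (intro full_subspace[OF sD]) (use eD d12 d in auto)
  have "form e u = 0" if "u \<in> span {d1, d2}" for u
    using that e by (auto simp: span_2)
  then have "form e u = 0" if "u \<in> dir U" for u
    using that unfolding D in_span_insert[of u e] by fastforce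
  then have "e \<in> Rad (dir U)" using eD by (simp add: in_Rad)
  moreover have "e \<noteq> 0" using e_out span_zero by blast
  ultimately show ?thesis by blast
qed

lemma even_radical_nonzero:
  assumes U: "is_object U" "even (dim U)"
  shows "\<exists>e\<in>Rad (dir U). e \<noteq> 0"
proof -
  have "dim U = 2 \<or> dim U = 4" using dim_object[OF U(1)] U(2) by (auto elim!: evenE)
  then show ?thesis
  proof
    assume "dim U = 2"
    then have d: "dim (dir U) = 1" using dim_dir[OF U(1)] by simp
    have sD: "subspace (dir U)" by (rule subspace_dir[OF object_subspace[OF U(1)]])
    obtain e where e: "e \<in> dir U" "e \<notin> span {}"
      using exists_outside_span[of "{}" "dir U"] d by auto
    then have "dir U = span {e}"
      by (intro full_subspace[OF sD]) (use d dim_insert[of e "{}"] in auto)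
    then have "e \<in> Rad (dir U)" using e by (auto simp: in_Rad span_1)
    then show ?thesis using e by auto
  qed (use dim4_radical_nonzero[OF U(1)] in blast)
qed

text \<open>Two points are joined in \<open>U\<close> if the line through them is incident with or equal to \<open>U\<close>. In
dimension 4 the pairs that differ by the radical direction are excluded.\<close>
definition joined :: "'v set \<Rightarrow> 'v \<Rightarrow> 'v \<Rightarrow> bool" where
  "joined U a b \<longleftrightarrow> a \<noteq> b \<and> \<not> (dim U = 4 \<and> a + b \<in> Rad (dir U))"

lemma joined_sym: "joined U a b \<Longrightarrow> joined U b a"
  by (auto simp: joined_def add.commute)

lemma hyperbolic_iff:
  "form (a + b) (a + c) = 1 \<longleftrightarrow> form a b + form a c + form b c = 1"
  by (simp add: form_commute[of b a] ac_simps)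

text \<open>Suppose that the two directions \<open>a + b\<close> and \<open>a + c\<close> are orthogonal. In dimension 3 they span all
directions, which are not totally isotropic. In dimension 4, add a third direction \<open>z\<close>; one of
\<open>a + b\<close>, \<open>a + c\<close>, \<open>b + c\<close> is orthogonal to \<open>z\<close> and hence radical, so two of the points are not joined.\<close>
lemma joined_triangle:
  assumes U: "is_object U" and pts: "a \<in> U" "point a" "b \<in> U" "point b" "c \<in> U" "point c"
    and j: "joined U a b" "joined U a c" "joined U b c"
  shows "form (a + b) (a + c) = 1"
proof (rule ccontr)
  let ?d = "a + b" and ?e = "a + c"
  assume "form ?d ?e \<noteq> 1"
  then have de: "form ?d ?e = 0" "form ?e ?d = 0" using field_cases form_commute by metis+
  have D: "?d \<in> dir U" "?e \<in> dir U" using point_add_dir[OF U] pts by auto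
  have sD: "subspace (dir U)" by (rule subspace_dir[OF object_subspace[OF U(1)]])
  have "a \<noteq> b" "a \<noteq> c" "b \<noteq> c" using j by (auto simp: joined_def)
  then have d2: "dim {?d, ?e} = 2" by (intro dim_2) auto
  have iso: "form u v = 0" if "u \<in> span {?d, ?e}" "v \<in> span {?d, ?e}" for u v
    using that de unfolding span_2 by (elim insertE emptyE) (simp_all del: form_add_left form_add_right add: form_add_left[of ?d ?e] form_add_right[of _ ?d ?e])
  have "dim (dir U) \<ge> 2" using dim_subset[of "{?d, ?e}" "dir U"] d2 D by auto
  then have "dim U = 3 \<or> dim U = 4" using dim_object[OF U] dim_dir[OF U] by auto
  then show False
  proof
    assume U3: "dim U = 3"
    then have "dir U = span {?d, ?e}"
      by (intro full_subspace[OF sD]) (use D d2 dim_dir[OF U] in auto)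
    then show False using dir_not_isotropic[OF U] U3 iso by fastforce
  next
    assume U4: "dim U = 4"
    then have d3: "dim (dir U) = 3" using dim_dir[OF U] by simp
    then obtain z where z: "z \<in> dir U" "z \<notin> span {?d, ?e}"
      using exists_outside_span[of "{?d, ?e}" "dir U"] d2 by auto
    have "dim {z, ?d, ?e} = 3" using z d2 by (simp add: dim_insert)
    then have DU: "dir U = span {z, ?d, ?e}"
      by (intro full_subspace[OF sD]) (use z D d3 in auto)
    have "form z ?d = 0 \<or> form z ?e = 0 \<or> form z (?d + ?e) = 0"
      using form_add_right[of z ?d ?e] by (metis field_cases field_double(1))
    then obtain x where x: "x \<in> {?d, ?e, ?d + ?e}" "form z x = 0" by blast
    have xs: "x \<in> span {?d, ?e}" using x by (auto simp: span_2)
    have "form x u = 0" if "u \<in> dir U" for u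
    proof -
      have "u \<in> span {?d, ?e} \<or> z + u \<in> span {?d, ?e}"
        using that unfolding DU in_span_insert[of u z] by blast
      then have "form x u = 0 \<or> form x (z + u) = 0" using iso xs by blast
      then show ?thesis using x(2) form_commute[of x z] form_add_right[of x z u] by auto
    qed
    moreover have "x \<in> dir U" using x D subspace_plus[OF sD] by auto
    ultimately have "x \<in> Rad (dir U)" by (simp add: in_Rad)
    moreover have "?d + ?e = b + c" by (simp add: ac_simps)
    ultimately show False using x(1) j U4 by (metis empty_iff insert_iff joined_def)
  qed
qed

lemma joined_detour:
  assumes U: "is_object U" and pts: "a \<in> U" "point a" "b \<in> U" "point b"
    and "a \<noteq> b" "\<not> joined U a b"
  shows "\<exists>c\<in>U. point c \<and> joined U a c \<and> joined U c b"
proof -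
  have U4: "dim U = 4" and ab: "a + b \<in> Rad (dir U)" using assms by (auto simp: joined_def)
  have sR: "subspace (Rad (dir U))" by (rule subspace_Rad[OF subspace_dir[OF object_subspace[OF U(1)]]])
  obtain d d2 where d: "d \<in> dir U" "d2 \<in> dir U" "form d d2 = 1"
    using dir_not_isotropic[OF U] U4 by fastforce
  then have dR: "d \<notin> Rad (dir U)" by (auto simp: in_Rad)
  have "a + d \<in> U \<and> point (a + d)" by (rule dir_add_point[OF U pts(1,2) d(1)])
  moreover have "(a + d) + b \<notin> Rad (dir U)"
  proof
    assume "(a + d) + b \<in> Rad (dir U)"
    from subspace_plus[OF sR ab this] show False using dR by (simp add: ac_simps)
  qed
  moreover from this have "a + d \<noteq> b" using subspace_0[OF sR] by auto
  moreover have "a \<noteq> a + d" using dR subspace_0[OF sR] by auto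
  ultimately show ?thesis using dR unfolding joined_def by (intro bexI[of _ "a + d"]) auto
qed

text \<open>The pair function \<open>form a b + 1\<close> summed along a path of joined points from \<open>a\<close> to a base
point \<open>b\<close> of \<open>U\<close>. If \<open>a\<close> and \<open>b\<close> are not joined, such a path needs a detour over a third point \<open>c\<close>,
and the sum \<open>form a c + form c b\<close> equals \<open>form a b\<close> because \<open>a + b\<close> is radical and thus orthogonal to \<open>b + c\<close>.\<close>
definition potential :: "'v set \<Rightarrow> 'v \<Rightarrow> 'f" where
  "potential U a = (let b = (SOME b. b \<in> U \<and> point b) in
     if a = b then 0 else if joined U a b then form a b + 1 else form a b)"

lemma potential_joined:
  assumes U: "is_object U" and pts: "a \<in> U" "point a" "c \<in> U" "point c" and j: "joined U a c"
  shows "potential U a + potential U c = form a c + 1"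
proof -
  define b where "b = (SOME b. b \<in> U \<and> point b)"
  have "\<exists>b. b \<in> U \<and> point b" using U by (auto simp: is_object_iff)
  then have b: "b \<in> U" "point b" unfolding b_def by (metis (mono_tags, lifting) someI_ex)+
  have pot: "potential U x = (if x = b then 0 else if joined U x b then form x b + 1 else form x b)" for x
    by (simp add: potential_def b_def[symmetric] Let_def)
  \<comment> \<open>Here \<open>y + b\<close> is radical, so \<open>b, x, y\<close> is an isotropic triangle; the missing summand 1
    in the potential of \<open>y\<close> compensates for it.\<close>
  have mixed: "potential U x + potential U y = form x y + 1"
    if x: "x \<in> U" "point x" and y: "y \<in> U" "point y" and "joined U x b" "\<not> joined U y b" "y \<noteq> b" for x y
  proof -
    have "y + b \<in> Rad (dir U)" using that by (auto simp: joined_def)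
    then have "form (y + b) (x + b) = 0" using point_add_dir[OF U x b] unfolding in_Rad by blast
    then have "form y x + form y b + form b x = 0" by (simp add: ac_simps)
    then have "form x y = form x b + form y b"
      by (metis add.commute field_double(2) form_commute add.right_neutral add.assoc)
    then show ?thesis using that by (auto simp: pot joined_def ac_simps)
  qed
  have "a \<noteq> c" using j by (simp add: joined_def)
  show ?thesis
  proof (cases "a = b \<or> c = b")
    case True
    then show ?thesis using j joined_sym[OF j] \<open>a \<noteq> c\<close> by (auto simp: pot form_commute)
  next
    case False
    consider "joined U a b" "joined U c b" | "joined U a b" "\<not> joined U c b" | "joined U c b" "\<not> joined U a b"
      | "\<not> joined U a b" "\<not> joined U c b" by blast
    then show ?thesis
    proof cases
      case 1
      have "form (a + b) (a + c) = 1"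
        by (rule joined_triangle[OF U pts(1,2) b pts(3,4)]) (use 1 j joined_sym in auto)
      then have "form a b + form a c + form b c = 1" by (simp add: hyperbolic_iff del: form_add_left form_add_right)
      then show ?thesis using False 1 field_cases[of "form a b"] field_cases[of "form a c"] field_cases[of "form c b"]
        by (auto simp: pot form_commute[of b c])
    next
      case 2
      then show ?thesis using mixed pts False by blast
    next
      case 3
      then have "potential U c + potential U a = form c a + 1" using mixed pts False by blast
      then show ?thesis by (simp add: add.commute form_commute)
    next
      case 4
      then have *: "dim U = 4" "a + b \<in> Rad (dir U)" "c + b \<in> Rad (dir U)" using False by (auto simp: joined_def)
      then have "(a + b) + (c + b) \<in> Rad (dir U)"
        using subspace_plus[OF subspace_Rad[OF subspace_dir[OF object_subspace[OF U(1)]]]] by blast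
      then have "a + c \<in> Rad (dir U)" by (simp add: ac_simps)
      then show ?thesis using j * by (simp add: joined_def)
    qed
  qed
qed

section \<open>Incidence and the transition cocycle\<close>

lemma Pi_below_iff:
  "Pi_below {0, p0} U W \<longleftrightarrow> U \<subseteq> W \<and> (even (dim W) \<longrightarrow> \<not> Rad (dir W) \<subseteq> U)"
  by (auto simp: Pi_below_def Int_perp_p)

sublocale Pi: incidence_geometry "Pi_geometry {0, p0} H"
  by unfold_locales (auto simp: Pi_geometry_def Pi_incident_def)

lemma Pi_geometry_simps [simp]:
  "objects (Pi_geometry {0, p0} H) = Pi_objects {0, p0} H"
  "incident (Pi_geometry {0, p0} H) = Pi_incident {0, p0}"
  by (simp_all add: Pi_geometry_def)

lemma incident_cases:
  assumes "Pi_incident {0, p0} U W"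
  obtains "U = W" | "dim U < dim W" "Pi_below {0, p0} U W" | "dim W < dim U" "Pi_below {0, p0} W U"
  using assms by (auto simp: Pi_incident_def)

text \<open>In dimension 4 the radical of the direction space is \<open>{0, e}\<close>. If the points differed by \<open>e\<close>,
the radical would be contained in \<open>U\<close>, which incidence forbids.\<close>
lemma below_joined:
  assumes "is_object U" "is_object W" "dim U < dim W" "Pi_below {0, p0} U W"
    and pts: "a \<in> U" "point a" "b \<in> U" "point b" "a \<noteq> b"
  shows "joined U a b \<and> joined W a b"
proof -
  have "dim W \<le> 4" using dim_object[OF assms(2)] by simp
  then have "joined U a b" using assms(3) pts by (simp add: joined_def)
  moreover have "joined W a b"
  proof (rule ccontr)
    assume "\<not> joined W a b"
    then have W4: "dim W = 4" and ab: "a + b \<in> Rad (dir W)" "a + b \<noteq> 0" using pts by (auto simp: joined_def)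
    have "x \<in> U" if "x \<in> Rad (dir W)" for x
      using dim4_radical_unique[OF assms(2) W4 that _ ab] subspace_0[OF object_subspace[OF assms(1)]]
        subspace_plus[OF object_subspace[OF assms(1)] pts(1,3)] by (cases "x = 0") auto
    then show False using assms(4) W4 by (auto simp: Pi_below_iff)
  qed
  ultimately show ?thesis ..
qed

lemma common_point:
  assumes "is_object U" "is_object W" "is_object X"
    and "Pi_incident {0, p0} U W" "Pi_incident {0, p0} W X" "Pi_incident {0, p0} U X"
  obtains a where "a \<in> U" "a \<in> W" "a \<in> X" "point a"
proof -
  have nested: "A \<subseteq> B \<or> B \<subseteq> A" if "Pi_incident {0, p0} A B" for A B
    using that by (rule incident_cases) (auto simp: Pi_below_iff)
  have "U \<subseteq> W \<inter> X \<or> W \<subseteq> U \<inter> X \<or> X \<subseteq> U \<inter> W"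
    using nested[OF assms(4)] nested[OF assms(5)] nested[OF assms(6)] by blast
  moreover have "\<exists>a\<in>A. point a" if "is_object A" for A using that by (simp add: is_object_iff)
  ultimately show ?thesis using that assms(1-3) by blast
qed

text \<open>The difference of the two potentials, which is the same at all common points of two incident objects
(\<open>transition_eq\<close>). In characteristic 2 it is symmetric in the two objects.\<close>
definition transition :: "'v set \<Rightarrow> 'v set \<Rightarrow> 'f" where
  "transition U W = (let a = (SOME a. a \<in> U \<and> a \<in> W \<and> point a) in potential U a + potential W a)"

text \<open>Two points of the smaller object are joined in both objects, so between them both potentials
change by the same amount \<open>form a b + 1\<close>.\<close>
lemma transition_eq:
  assumes U: "is_object U" and W: "is_object W" and inc: "Pi_incident {0, p0} U W"
    and a: "a \<in> U" "a \<in> W" "point a"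
  shows "transition U W = potential U a + potential W a"
proof -
  define b where "b = (SOME a. a \<in> U \<and> a \<in> W \<and> point a)"
  have b: "b \<in> U \<and> b \<in> W \<and> point b" unfolding b_def by (rule someI[of _ a]) (use a in blast)
  have indep: "potential A b + potential B b = potential A a + potential B a"
    if A: "is_object A" "b \<in> A" "a \<in> A" and B: "is_object B" "b \<in> B" "a \<in> B"
      and AB: "dim A < dim B" "Pi_below {0, p0} A B" "a \<noteq> b" for A B
  proof -
    have j: "joined A b a \<and> joined B b a"
      using below_joined[OF A(1) B(1) AB(1,2), of b a] A B AB(3) a b by blast
    have "potential A b + potential A a = potential B b + potential B a"
      using potential_joined[OF A(1), of b a] potential_joined[OF B(1), of b a] j A B a b by simp
    then have "(potential A b + potential A a) + (potential A a + potential B b) =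
       (potential B b + potential B a) + (potential A a + potential B b)" by simp
    then show ?thesis by (simp add: ac_simps)
  qed
  have "potential U b + potential W b = potential U a + potential W a"
  proof (cases "a = b")
    case False
    from inc show ?thesis
    proof (cases rule: incident_cases)
      case 2
      then show ?thesis using indep[of U W] U W a b False by blast
    next
      case 3
      then have "potential W b + potential U b = potential W a + potential U a"
        using indep[of W U] U W a b False by blast
      then show ?thesis by (simp add: add.commute)
    qed simp
  qed simp
  then show ?thesis by (simp add: transition_def b_def[symmetric] Let_def)
qed

lemma transition_cocycle:
  assumes "is_object U" "is_object W" "is_object X"
    and "Pi_incident {0, p0} U W" "Pi_incident {0, p0} W X" "Pi_incident {0, p0} U X"
  shows "transition U W + transition W X = transition U X"
proof -
  obtain a where "a \<in> U" "a \<in> W" "a \<in> X" "point a" using common_point[OF assms] .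
  then show ?thesis using assms by (simp add: transition_eq[of _ _ a] ac_simps)
qed

lemma point_incident:
  assumes W: "is_object W" and a: "a \<in> W" "point a"
  shows "Pi_incident {0, p0} {0, a} W"
proof (cases "dim W = 1")
  case True
  have "W = span {a}"
    by (rule full_subspace[OF object_subspace[OF W]])
      (use a True dim_insert[of a "{}"] point_nonzero in auto)
  then show ?thesis by (simp add: span_1 Pi_incident_def)
next
  case False
  then have "dim {0, a} < dim W" using dim_object[OF W] point_object[OF a(2)] by simp
  moreover have "{0, a} \<subseteq> W" using a subspace_0[OF object_subspace[OF W]] by simp
  moreover have "\<not> Rad (dir W) \<subseteq> {0, a}" if "even (dim W)"
    using even_radical_nonzero[OF W that] a(2) Rad_subset[of "dir W"] by (auto simp: dir_def point_def)
  ultimately show ?thesis by (simp add: Pi_incident_def Pi_below_iff)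
qed

lemma line_incident:
  assumes W: "is_object W" and pts: "a \<in> W" "point a" "b \<in> W" "point b" and j: "joined W a b"
  shows "Pi_incident {0, p0} (line a b) W"
proof -
  have sW: "subspace W" by (rule object_subspace[OF W])
  have ab: "a \<noteq> b" using j by (simp add: joined_def)
  have sub: "line a b \<subseteq> W" using pts subspace_0[OF sW] subspace_plus[OF sW] by auto
  have d: "dim (line a b) = 2" using line_object[OF pts(2,4) ab] by simp
  then have "dim W \<ge> 2" using dim_subset[OF sub] by simp
  then consider "dim W = 2" | "dim W = 3" | "dim W = 4" using dim_object[OF W] by force
  then show ?thesis
  proof cases
    case 1
    then have "W = span {a, b}"
      by (intro full_subspace[OF sW]) (use pts dim_2[of a b] point_nonzero ab in auto)
    then show ?thesis by (simp add: span_2 Pi_incident_def)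
  next
    case 2
    then show ?thesis using d sub by (simp add: Pi_incident_def Pi_below_iff)
  next
    case 3
    obtain e where e: "e \<in> Rad (dir W)" "e \<noteq> 0" using even_radical_nonzero[OF W] 3 by auto
    have "e \<notin> line a b"
    proof
      assume "e \<in> line a b"
      moreover have "form p0 e = 0" using e Rad_subset[of "dir W"] by (auto simp: dir_def)
      ultimately have "e = a + b" using e pts by (auto simp: point_def)
      then show False using j 3 e by (simp add: joined_def)
    qed
    then have "\<not> Rad (dir W) \<subseteq> line a b" using e(1) by blast
    then show ?thesis using d sub 3 by (simp add: Pi_incident_def Pi_below_iff)
  qed
qed

section \<open>The space of translations\<close>

lemma exists_point: "\<exists>a. point a"
proof -
  obtain y where y: "form p0 y = 1" using form_nondegenerate[of p0] p0_nonzero field_cases by blast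
  then have "form p0 (p0 + y) = 1" by simp
  then show ?thesis using H_cover[of y] y by (auto simp: point_def)
qed

lemma dim_dir_H: "dim (dir H) = 4"
  using exists_point dim_dir_subspace[OF subspace_H] dim_H by (auto simp: point_def)

lemma dir_H_plus: "x \<in> dir H \<Longrightarrow> y \<in> dir H \<Longrightarrow> x + y \<in> dir H"
  by (rule subspace_plus[OF subspace_dir[OF subspace_H]])

text \<open>If \<open>k\<close> is orthogonal to all directions, then on \<open>H\<close> its pairing is a multiple of the one
with \<open>p0\<close>. So \<open>k\<close> differs from a multiple of \<open>p0\<close> by a vector orthogonal to \<open>H\<close> and \<open>p0\<close>, hence to everything,
and \<open>p0\<close> is not in \<open>H\<close>.\<close>
lemma dir_H_nondegenerate:
  assumes k: "k \<in> dir H" "k \<noteq> 0"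
  shows "\<exists>y\<in>dir H. form k y = 1"
proof (rule ccontr)
  assume "\<not> ?thesis"
  then have K: "form k y = 0" if "y \<in> dir H" for y using that field_cases by blast
  obtain o1 where o1: "point o1" using exists_point ..
  have "form (k + form k o1 *s p0) x = 0" if x: "x \<in> H" for x
  proof -
    consider "x \<in> dir H" | "o1 + x \<in> dir H"
      using dir_or_translate[OF subspace_H _ o1, of x] o1 x by (auto simp: point_def)
    then show ?thesis
    proof cases
      case 1
      then show ?thesis using K[of x] field_cases[of "form k o1"] by (auto simp: dir_def)
    next
      case 2
      then have "form k o1 + form k x = 0" "form p0 o1 + form p0 x = 0" using K[of "o1 + x"] by (auto simp: dir_def)
      then show ?thesis using field_cases[of "form k o1"] field_cases[of "form k x"] field_cases[of "form p0 x"] o1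
        by (auto simp: point_def)
    qed
  qed
  moreover have "form (k + form k o1 *s p0) p0 = 0"
    using k field_cases[of "form k o1"] form_commute[of k p0] by (auto simp: dir_def)
  ultimately have "form (k + form k o1 *s p0) v = 0" for v
    using H_cover[of v] by (metis add_0 form_add_right)
  then have "k + form k o1 *s p0 = 0" using form_nondegenerate by blast
  then have "k = p0" using k field_cases[of "form k o1"] by auto
  then show False using k p0_notin_H by (simp add: dir_def)
qed

lemma separate:
  assumes "c \<in> dir H" "d \<in> dir H" "c \<noteq> 0" "c \<noteq> d"
  shows "\<exists>y\<in>dir H. form d y = 0 \<and> form c y = 1"
proof -
  obtain y where y: "y \<in> dir H" "form c y = 1" using dir_H_nondegenerate assms by blast
  obtain z where z: "z \<in> dir H" "form (c + d) z = 1"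
    using dir_H_nondegenerate[OF dir_H_plus[OF assms(1,2)]] assms(4) by auto
  show ?thesis
  proof (cases "form d y = 0 \<or> form d z = 0")
    case True
    then show ?thesis using y z by auto
  next
    case False
    then have "form d (y + z) = 0 \<and> form c (y + z) = 1" using y z field_cases[of "form c z"] by auto
    then show ?thesis using dir_H_plus y z by blast
  qed
qed

text \<open>If a vector chosen for \<open>c\<close> fails for \<open>c'\<close> and vice versa, their sum works for both.\<close>
lemma separate_both:
  assumes "c \<in> dir H" "c' \<in> dir H" "d \<in> dir H" "c \<noteq> 0" "c \<noteq> d" "c' \<noteq> 0" "c' \<noteq> d"
  shows "\<exists>y\<in>dir H. form d y = 0 \<and> form c y = 1 \<and> form c' y = 1"
proof -
  obtain y where y: "y \<in> dir H" "form d y = 0" "form c y = 1" using separate assms by blast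
  obtain z where z: "z \<in> dir H" "form d z = 0" "form c' z = 1" using separate assms by blast
  show ?thesis
  proof (cases "form c' y = 1 \<or> form c z = 1")
    case True
    then show ?thesis using y z by blast
  next
    case False
    then have "form c' y = 0" "form c z = 0" using field_cases by blast+
    then have "form d (y + z) = 0 \<and> form c (y + z) = 1 \<and> form c' (y + z) = 1" using y z by auto
    then show ?thesis using dir_H_plus y z by blast
  qed
qed

text \<open>The component orthogonal to \<open>b\<close> and \<open>c\<close> of a vector outside \<open>span {b, c}\<close>; such a vector exists since the space of
directions has dimension 4.\<close>
lemma orthogonal_to_hyperbolic_pair:
  assumes "b \<in> dir H" "c \<in> dir H" "form b c = 1"
  shows "\<exists>a\<in>dir H. a \<noteq> 0 \<and> form a b = 0 \<and> form a c = 0"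
proof -
  have cb: "form c b = 1" using assms form_commute by metis
  have "dim {b, c} \<le> 2" using dim_le_card'[of "{b, c}"] card_insert_le_m1[of 2 "{c}" b] by auto
  then obtain x where x: "x \<in> dir H" "x \<notin> span {b, c}"
    using exists_outside_span[of "{b, c}" "dir H"] dim_dir_H by auto
  define w where "w = form x c *s b + form x b *s c"
  have w: "w \<in> span {b, c}" unfolding w_def by (intro span_add span_scale span_base) auto
  have "x \<noteq> w" using x w by blast
  moreover have "form (x + w) b = 0" "form (x + w) c = 0"
    using field_cases[of "form x b"] field_cases[of "form x c"] assms(3) cb by (auto simp: w_def)
  moreover have "w \<in> dir H"
    using w span_subset[OF subspace_dir[OF subspace_H], of "{b, c}"] assms by auto
  ultimately show ?thesis using dir_H_plus[OF x(1)] by (intro bexI[of _ "x + w"]) auto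
qed

section \<open>The generator of order two\<close>

text \<open>The normalised cocycle \<open>G a b\<close> is trivial on hyperbolic pairs, because with 0 they form a
triangle on which the cocycle condition holds. For orthogonal pairs \<open>c, d\<close> and \<open>c', d\<close> there is a \<open>y\<close> orthogonal to \<open>d\<close> and hyperbolic
with \<open>c\<close> and \<open>c'\<close>, and the triangles \<open>c, y, d\<close> and \<open>c', y, d\<close> give \<open>G c d = G y d = G c' d\<close>. So \<open>G c d\<close>
depends on \<open>d\<close> only, and the remaining argument exchanges the two entries inside a totally isotropic plane.\<close>
lemma isotropic_generator:
  fixes \<G> (structure) and \<gamma>
  assumes "group \<G>"
    and closed: "\<And>a b. a \<in> dir H \<Longrightarrow> b \<in> dir H \<Longrightarrow> \<gamma> a b \<in> carrier \<G>"
    and loop: "\<And>a. a \<in> dir H \<Longrightarrow> \<gamma> a a = \<one>"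
    and reverse: "\<And>a b. a \<in> dir H \<Longrightarrow> b \<in> dir H \<Longrightarrow> \<gamma> a b \<otimes> \<gamma> b a = \<one>"
    and triangle: "\<And>a b c. a \<in> dir H \<Longrightarrow> b \<in> dir H \<Longrightarrow> c \<in> dir H \<Longrightarrow> form (a + b) (a + c) = 1 \<Longrightarrow>
      \<gamma> a b \<otimes> \<gamma> b c = \<gamma> a c"
  shows "\<exists>t\<in>carrier \<G>. t \<otimes> t = \<one> \<and>
    (\<forall>a\<in>dir H. \<forall>b\<in>dir H. \<gamma> 0 a \<otimes> \<gamma> a b \<otimes> \<gamma> b 0 \<in> {\<one>, t})"
proof -
  interpret group \<G> by fact
  let ?K = "dir H"
  have z: "0 \<in> ?K" by (rule subspace_0[OF subspace_dir[OF subspace_H]])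
  define G where "G a b = \<gamma> 0 a \<otimes> \<gamma> a b \<otimes> \<gamma> b 0" for a b
  have Gc: "G a b \<in> carrier \<G>" if "a \<in> ?K" "b \<in> ?K" for a b
    using that z by (simp add: G_def closed)
  have cancel: "\<gamma> a b \<otimes> (\<gamma> b a \<otimes> x) = x" if "a \<in> ?K" "b \<in> ?K" "x \<in> carrier \<G>" for a b x
    using that by (simp add: m_assoc[symmetric] closed reverse)
  have G_mult: "G a b \<otimes> G b c = \<gamma> 0 a \<otimes> (\<gamma> a b \<otimes> \<gamma> b c) \<otimes> \<gamma> c 0" if "a \<in> ?K" "b \<in> ?K" "c \<in> ?K" for a b c
    using that z by (simp add: G_def m_assoc closed cancel)
  have G_reverse: "G a b \<otimes> G b a = \<one>" if "a \<in> ?K" "b \<in> ?K" for a b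
    using G_mult[OF that that(1)] that z by (simp add: reverse closed)
  have G_triangle: "G a b \<otimes> G b c = G a c"
    if "a \<in> ?K" "b \<in> ?K" "c \<in> ?K" "form a b + form a c + form b c = 1" for a b c
    using G_mult[OF that(1-3)] triangle[OF that(1-3)] that(4) unfolding hyperbolic_iff by (simp add: G_def)
  have G_hyperbolic: "G a b = \<one>" if "a \<in> ?K" "b \<in> ?K" "form a b = 1" for a b
  proof -
    have "\<gamma> 0 a \<otimes> \<gamma> a b = \<gamma> 0 b" using triangle[OF z that(1,2)] that by simp
    then show ?thesis using that z by (simp add: G_def reverse)
  qed
  have G_step: "G c d = G c' d"
    if "c \<in> ?K" "c' \<in> ?K" "d \<in> ?K" "form c d = 0" "form c' d = 0" "form c c' = 1" for c c' d
    using G_triangle[of c c' d] G_hyperbolic[of c c'] that Gc by simp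
  define iso where "iso a b \<longleftrightarrow> a \<in> ?K \<and> b \<in> ?K \<and> a \<noteq> 0 \<and> b \<noteq> 0 \<and> a \<noteq> b \<and> form a b = 0" for a b
  have iso_sym: "iso b a" if "iso a b" for a b
    using that form_commute by (auto simp: iso_def)
  have G_first: "G c d = G c' d" if cd: "iso c d" "iso c' d" for c c' d
  proof -
    obtain y where y: "y \<in> ?K" "form d y = 0" "form c y = 1" "form c' y = 1"
      using separate_both[of c c' d] cd by (auto simp: iso_def)
    then have "form y d = 0" using form_commute by metis
    then have "G c d = G y d" "G c' d = G y d" using G_step y that by (auto simp: iso_def)
    then show ?thesis by simp
  qed
  have G_inv: "G b a = inv (G a b)" if "iso a b" for a b
    using inv_equality[of "G b a" "G a b"] G_reverse[of b a] Gc that by (auto simp: iso_def)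
  have G_comm: "G b c = G c b" if bc: "iso b c" for b c
  proof -
    have i: "iso (b + c) c" "iso (b + c) b" 
      using bc dir_H_plus form_commute[of c b] by (auto simp: iso_def)
    \<comment> \<open>On the totally isotropic plane \<open>{0, b, c, b + c}\<close> changing first arguments and inverting
      alternately leads from \<open>(b, c)\<close> to \<open>(c, b)\<close> with two inversions.\<close>
    have "G b c = G (b + c) c" by (rule G_first[OF bc i(1)])
    also have "\<dots> = inv (G c (b + c))" by (rule G_inv[OF iso_sym[OF i(1)]])
    also have "G c (b + c) = G b (b + c)" by (rule G_first[OF iso_sym[OF i(1)] iso_sym[OF i(2)]])
    also have "inv (G b (b + c)) = G (b + c) b" by (rule G_inv[OF iso_sym[OF i(2)], symmetric])
    also have "\<dots> = G c b" by (rule G_first[OF i(2) iso_sym[OF bc]])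
    finally show ?thesis .
  qed
  have G_square: "G b c \<otimes> G b c = \<one>" if "iso b c" for b c
    using G_comm[OF that] G_reverse[of b c] that by (simp add: iso_def)
  have G_link: "G a d = G a' d'" if "iso a d" "iso a' d'" "iso d d'" for a d a' d'
  proof -
    have "G a d = G d' d" by (rule G_first[OF that(1) iso_sym[OF that(3)]])
    also have "\<dots> = G d d'" by (rule G_comm[OF iso_sym[OF that(3)]])
    also have "\<dots> = G a' d'" by (rule G_first[OF that(3,2)])
    finally show ?thesis .
  qed
  have G_const: "G a d = G a' d'" if isos: "iso a d" "iso a' d'" for a d a' d'
  proof -
    consider "d = d'" | "iso d d'" | "form d d' = 1"
      using isos field_cases[of "form d d'"] by (auto simp: iso_def)
    then show ?thesis
    proof cases
      case 1
      then show ?thesis using G_first isos by blast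
    next
      case 2
      then show ?thesis using G_link isos by blast
    next
      case 3
      then obtain m where m: "m \<in> ?K" "m \<noteq> 0" "form m d = 0" "form m d' = 0"
        using orthogonal_to_hyperbolic_pair[of d d'] isos by (auto simp: iso_def)
      then have "iso m d" "iso m d'" using isos 3 form_commute[of d d'] by (auto simp: iso_def)
      then show ?thesis using G_link[of a d d m] G_link[of d m a' d'] isos iso_sym by metis
    qed
  qed
  have G_trivial: "G a b = \<one>" if ab: "a \<in> ?K" "b \<in> ?K" "\<not> iso a b" for a b
  proof -
    consider "a = 0" | "b = 0" | "a = b" | "form a b = 1"
      using ab field_cases[of "form a b"] by (auto simp: iso_def)
    then show ?thesis
    proof cases
      case 4
      then show ?thesis using G_hyperbolic ab by blast
    qed (use ab z in \<open>simp_all add: G_def loop reverse closed\<close>)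
  qed
  show ?thesis
  proof (cases "\<exists>a b. iso a b")
    case True
    then obtain a b where ab: "iso a b" by blast
    have "G c d \<in> {\<one>, G a b}" if "c \<in> ?K" "d \<in> ?K" for c d
      using G_trivial[OF that] G_const[OF _ ab] by blast
    then show ?thesis
      using Gc G_square[OF ab] ab unfolding G_def[symmetric] iso_def by blast
  next
    case False
    then show ?thesis using G_trivial unfolding G_def[symmetric] by (intro bexI[of _ "\<one>"]) auto
  qed
qed

text \<open>For points \<open>a, b\<close> let \<open>\<Gamma> a b\<close> be the product along the edge path over their line. It equals the
product over any object in which \<open>a, b\<close> are joined, so \<open>\<Gamma>\<close> satisfies the cocycle condition on
hyperbolic triangles and \<open>isotropic_generator\<close> applies to it. The gauge at an object \<open>U\<close> is the product
along a path from a base point over a chosen point of \<open>U\<close> to \<open>U\<close>; then every edge becomes a product along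
a closed path over two points of the larger object.\<close>
lemma edge_gauge:
  fixes \<G> (structure) and g
  assumes "group \<G>"
    and closed: "\<And>U W. is_object U \<Longrightarrow> is_object W \<Longrightarrow> Pi_incident {0, p0} U W \<Longrightarrow> g U W \<in> carrier \<G>"
    and cocycle: "\<And>U W X. is_object U \<Longrightarrow> is_object W \<Longrightarrow> is_object X \<Longrightarrow> Pi_incident {0, p0} U W \<Longrightarrow>
      Pi_incident {0, p0} W X \<Longrightarrow> Pi_incident {0, p0} U X \<Longrightarrow> g U W \<otimes> g W X = g U X"
  obtains h t where "t \<in> carrier \<G>" "t \<otimes> t = \<one>" "\<And>U. is_object U \<Longrightarrow> h U \<in> carrier \<G>"
    "\<And>U W. is_object U \<Longrightarrow> is_object W \<Longrightarrow> Pi_incident {0, p0} U W \<Longrightarrow>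
       h U \<otimes> g U W \<otimes> inv (h W) \<in> {\<one>, t}"
proof -
  interpret group \<G> by fact
  note sym = Pi.incident_sym[unfolded Pi_geometry_simps] and refl = Pi.incident_refl[unfolded Pi_geometry_simps]
  have g_refl: "g U U = \<one>" if "is_object U" for U
    using cocycle[of U U U] closed[of U U] that refl r_cancel_one by metis
  have g_reverse: "g U W \<otimes> g W U = \<one>" if "is_object U" "is_object W" "Pi_incident {0, p0} U W" for U W
    using cocycle[of U W U] that sym refl g_refl by metis
  have g_cancel: "g U W \<otimes> (g W U \<otimes> x) = x"
    if "is_object U" "is_object W" "Pi_incident {0, p0} U W" "x \<in> carrier \<G>" for U W x
    using that sym[OF that(3)] by (simp add: m_assoc[symmetric] closed g_reverse)
  define \<Gamma> where "\<Gamma> a b = (if a = b then \<one> else g {0, a} (line a b) \<otimes> g (line a b) {0, b})" for a b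
  have \<Gamma>_via: "\<Gamma> a b = g {0, a} W \<otimes> g W {0, b}"
    if W: "is_object W" and a: "a \<in> W" "point a" and b: "b \<in> W" "point b" and j: "joined W a b" for W a b
  proof -
    let ?A = "{0, a}" and ?B = "{0, b}" and ?L = "line a b"
    have ab: "a \<noteq> b" using j by (simp add: joined_def)
    have o: "is_object ?A" "is_object ?B" "is_object ?L" using point_object line_object a b ab by auto
    have i: "Pi_incident {0, p0} ?A ?L" "Pi_incident {0, p0} ?B ?L" "Pi_incident {0, p0} ?A W"
        "Pi_incident {0, p0} ?B W" "Pi_incident {0, p0} ?L W"
      using point_incident[OF o(3)] point_incident[OF W] line_incident[OF W a b j] a b by auto
    note i' = i[THEN sym]
    have "g ?A W = g ?A ?L \<otimes> g ?L W" "g W ?B = g W ?L \<otimes> g ?L ?B"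
      using cocycle[of ?A ?L W] cocycle[of W ?L ?B] o W i i' by auto
    then show ?thesis using o W i i' ab by (simp add: \<Gamma>_def m_assoc closed g_cancel)
  qed
  have \<Gamma>_line: "\<Gamma> a b = g {0, a} (line a b) \<otimes> g (line a b) {0, b}" if "a \<noteq> b" for a b
    using that by (simp add: \<Gamma>_def)
  have li: "is_object (line a b)" "Pi_incident {0, p0} {0, a} (line a b)" "Pi_incident {0, p0} {0, b} (line a b)"
     "Pi_incident {0, p0} (line a b) {0, a}" "Pi_incident {0, p0} (line a b) {0, b}"
    if "point a" "point b" "a \<noteq> b" for a b
    using line_object[OF that] point_incident[OF line_object(1)[OF that]] that sym by auto
  have \<Gamma>_closed: "\<Gamma> a b \<in> carrier \<G>" if "point a" "point b" for a b
    using that li[OF that] point_object by (simp add: \<Gamma>_def closed)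
  have \<Gamma>_reverse: "\<Gamma> a b \<otimes> \<Gamma> b a = \<one>" if "point a" "point b" for a b
  proof (cases "a = b")
    case False
    have "line b a = line a b" by (auto simp: add.commute)
    then have "\<Gamma> b a = g {0, b} (line a b) \<otimes> g (line a b) {0, a}" using False by (simp add: \<Gamma>_def)
    then show ?thesis
      using that li[OF that False] point_object False
      by (simp add: \<Gamma>_line m_assoc closed g_cancel g_reverse)
  qed (simp add: \<Gamma>_def)
  have \<Gamma>_triangle: "\<Gamma> a b \<otimes> \<Gamma> b c = \<Gamma> a c" if pts: "point a" "point b" "point c" and f: "form (a + b) (a + c) = 1" for a b c
  proof -
    let ?P = "span {a, b, c}"
    have P: "is_object ?P" "dim ?P = 3" using plane_object[OF pts f] by auto
    have "a \<noteq> b" "a \<noteq> c" "b \<noteq> c" using f by (auto simp: form_commute[of c a])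
    then have j: "joined ?P a b" "joined ?P b c" "joined ?P a c" by (auto simp: joined_def P(2) simp del: dim_span)
    have in_P: "a \<in> ?P" "b \<in> ?P" "c \<in> ?P" by (auto simp: span_base)
    note i = point_incident[OF P(1)]
    show ?thesis
      using \<Gamma>_via[OF P(1)] in_P j pts i[of a] i[of b] i[of c] i[of a, THEN sym] i[of b, THEN sym] i[of c, THEN sym] point_object(1) P(1)
      by (simp add: m_assoc closed g_cancel)
  qed
  obtain o1 where o1: "point o1" using exists_point ..
  have pt: "point (o1 + k)" if "k \<in> dir H" for k
    using that o1 subspace_plus[OF subspace_H] by (auto simp: dir_def point_def)
  define \<gamma> where "\<gamma> k l = \<Gamma> (o1 + k) (o1 + l)" for k l
  have \<gamma>_triangle: "\<gamma> a b \<otimes> \<gamma> b c = \<gamma> a c"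
    if "a \<in> dir H" "b \<in> dir H" "c \<in> dir H" "form (a + b) (a + c) = 1" for a b c
  proof -
    have "(o1 + a) + (o1 + b) = a + b" "(o1 + a) + (o1 + c) = a + c" by (simp_all add: ac_simps)
    then have "form ((o1 + a) + (o1 + b)) ((o1 + a) + (o1 + c)) = 1" using that(4) by argo
    then show ?thesis unfolding \<gamma>_def using \<Gamma>_triangle pt that by blast
  qed
  have \<gamma>_closed: "\<gamma> a b \<in> carrier \<G>" and \<gamma>_reverse: "\<gamma> a b \<otimes> \<gamma> b a = \<one>"
    if "a \<in> dir H" "b \<in> dir H" for a b
    using that \<Gamma>_closed \<Gamma>_reverse pt by (simp_all add: \<gamma>_def)
  have \<gamma>_loop: "\<gamma> a a = \<one>" for a by (simp add: \<gamma>_def \<Gamma>_def)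
  have "\<exists>t\<in>carrier \<G>. t \<otimes> t = \<one> \<and>
    (\<forall>a\<in>dir H. \<forall>b\<in>dir H. \<gamma> 0 a \<otimes> \<gamma> a b \<otimes> \<gamma> b 0 \<in> {\<one>, t})"
    by (rule isotropic_generator[OF assms(1) \<gamma>_closed \<gamma>_loop \<gamma>_reverse \<gamma>_triangle])
  then obtain t where t: "t \<in> carrier \<G>" "t \<otimes> t = \<one>"
    and t': "\<And>k l. k \<in> dir H \<Longrightarrow> l \<in> dir H \<Longrightarrow> \<gamma> 0 k \<otimes> \<gamma> k l \<otimes> \<gamma> l 0 \<in> {\<one>, t}"
    by blast
  have in_t: "\<Gamma> o1 a \<otimes> \<Gamma> a b \<otimes> \<Gamma> b o1 \<in> {\<one>, t}" if "point a" "point b" for a b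
  proof -
    have "o1 + a \<in> dir H" "o1 + b \<in> dir H"
      using that o1 subspace_plus[OF subspace_H] by (auto simp: dir_def point_def)
    from t'[OF this] show ?thesis by (simp add: \<gamma>_def)
  qed
  \<comment> \<open>Points of \<open>W\<close> that are not joined in \<open>W\<close> are handled by a detour over a third point.\<close>
  define M where "M a b W = \<Gamma> o1 a \<otimes> (g {0, a} W \<otimes> g W {0, b}) \<otimes> \<Gamma> b o1" for a b W
  have M: "M a b W \<in> {\<one>, t}"
    if W: "is_object W" and a: "a \<in> W" "point a" and b: "b \<in> W" "point b" for a b W
  proof -
    have j: "M x y W \<in> {\<one>, t}" if "x \<in> W" "point x" "y \<in> W" "point y" "joined W x y" for x y
      using in_t[OF that(2,4)] \<Gamma>_via[OF W that] by (simp add: M_def)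
    consider "a = b" | "joined W a b" | c where "c \<in> W" "point c" "joined W a c" "joined W c b"
      using joined_detour[OF W a b] by blast
    then show ?thesis
    proof cases
      case 1
      then show ?thesis
        using \<Gamma>_reverse[OF o1 b(2)] point_incident[OF W b] \<Gamma>_closed[OF o1 b(2)] g_reverse[OF _ W, of "{0, b}"] point_object[OF b(2)]
        by (simp add: M_def)
    next
      case 2
      then show ?thesis using j a b by blast
    next
      case (3 c)
      have pc: "\<Gamma> c o1 \<otimes> (\<Gamma> o1 c \<otimes> x) = x" if "x \<in> carrier \<G>" for x
        using that 3 o1 by (simp add: m_assoc[symmetric] \<Gamma>_closed \<Gamma>_reverse)
      note i = point_incident[OF W]
      have "M a b W = M a c W \<otimes> M c b W"
        unfolding M_def
        using 3 a b o1 W point_object(1) i[of a] i[of b] i[of c] i[of a, THEN sym] i[of b, THEN sym] i[of c, THEN sym]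
        by (simp add: m_assoc closed g_cancel \<Gamma>_closed pc)
      then show ?thesis using j[OF a 3(1-3)] j[OF 3(1,2) b 3(4)] t by auto
    qed
  qed
  define u where "u U = (SOME a. a \<in> U \<and> point a)" for U
  have u: "u U \<in> U" "point (u U)" if "is_object U" for U
  proof -
    have "\<exists>a. a \<in> U \<and> point a" using that by (auto simp: is_object_iff)
    from someI_ex[OF this] show "u U \<in> U" "point (u U)" by (simp_all add: u_def)
  qed
  define h where "h U = \<Gamma> o1 (u U) \<otimes> g {0, u U} U" for U
  have ui: "is_object {0, u U}" "Pi_incident {0, p0} {0, u U} U" "Pi_incident {0, p0} U {0, u U}" if "is_object U" for U
    using point_object(1)[OF u(2)[OF that]] point_incident[OF that u[OF that]] sym by auto
  have h_closed: "h U \<in> carrier \<G>" if "is_object U" for U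
    using u[OF that] o1 ui[OF that] that by (simp add: h_def \<Gamma>_closed closed)
  have h_inv: "inv (h U) = g U {0, u U} \<otimes> \<Gamma> (u U) o1" if U: "is_object U" for U
  proof (rule inv_equality)
    have "\<Gamma> (u U) o1 \<otimes> (\<Gamma> o1 (u U) \<otimes> x) = x" if "x \<in> carrier \<G>" for x
      using that u[OF U] o1 by (simp add: m_assoc[symmetric] \<Gamma>_closed \<Gamma>_reverse)
    then show "g U {0, u U} \<otimes> \<Gamma> (u U) o1 \<otimes> h U = \<one>"
      using u[OF U] o1 ui[OF U] U by (simp add: h_def m_assoc \<Gamma>_closed closed g_reverse)
  qed (use h_closed[OF U] u[OF U] o1 ui[OF U] U in \<open>simp_all add: \<Gamma>_closed closed\<close>)
  have up: "h U \<otimes> g U W \<otimes> inv (h W) \<in> {\<one>, t}"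
    if U: "is_object U" and W: "is_object W" and UW: "Pi_incident {0, p0} U W" "U \<subseteq> W" for U W
  proof -
    have i: "Pi_incident {0, p0} {0, u U} W" using point_incident[OF W] u[OF U] UW by blast
    then have "g {0, u U} U \<otimes> g U W = g {0, u U} W"
      using cocycle ui[OF U] U W UW by blast
    then have "h U \<otimes> g U W = \<Gamma> o1 (u U) \<otimes> g {0, u U} W"
      using u[OF U] o1 ui[OF U] U W UW by (simp add: h_def m_assoc \<Gamma>_closed closed)
    then have "h U \<otimes> g U W \<otimes> inv (h W) = M (u U) (u W) W"
      unfolding h_inv[OF W] M_def
      using u[OF U] u[OF W] o1 ui[OF U] ui[OF W] W i by (simp add: m_assoc \<Gamma>_closed closed)
    then show ?thesis using M[OF W] u[OF U] u[OF W] UW by auto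
  qed
  show ?thesis
  proof (rule that[OF t h_closed])
    fix U W assume U: "is_object U" and W: "is_object W" and UW: "Pi_incident {0, p0} U W"
    from UW have "U \<subseteq> W \<or> W \<subseteq> U" by (rule incident_cases) (auto simp: Pi_below_iff)
    then show "h U \<otimes> g U W \<otimes> inv (h W) \<in> {\<one>, t}"
    proof
      assume "W \<subseteq> U"
      note WU = up[OF W U sym[OF UW] this]
      have "h U \<otimes> g U W \<otimes> inv (h W) = inv (h W \<otimes> g W U \<otimes> inv (h U))"
      proof -
        have "inv (g W U) = g U W" using inv_equality[of "g U W" "g W U"] g_reverse[OF U W UW] closed U W UW sym[OF UW] by simp
        then show ?thesis using h_closed U W closed UW sym[OF UW] by (simp add: inv_mult_group m_assoc)
      qed
      moreover have "inv t = t" using inv_equality[OF t(2) t(1) t(1)] .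
      ultimately show ?thesis using WU by auto
    qed (use up U W UW in blast)
  qed
qed

section \<open>The fundamental group of the geometry\<close>

lemma connected: "connected_geometry (Pi_geometry {0, p0} H)"
proof -
  let ?G = "Pi_geometry {0, p0} H"
  define reach where "reach U W \<longleftrightarrow> (\<exists>xs. is_path ?G xs \<and> hd xs = U \<and> last xs = W)" for U W
  have reach_trans: "reach U X" if UW: "reach U W" and WX: "reach W X" for U W X
  proof -
    obtain xs ys where xs: "is_path ?G xs" "hd xs = U" "last xs = W" and ys: "is_path ?G ys" "hd ys = W" "last ys = X"
      using UW WX unfolding reach_def by blast
    have ne: "xs \<noteq> []" "ys \<noteq> []" using xs ys path_nonempty by blast+
    have "last xs = hd ys" using xs ys by simp
    then show ?thesis
      unfolding reach_def using is_path_append[OF xs(1) ys(1)] last_append_tl[OF ne] xs ys ne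
      by (intro exI[of _ "xs @ tl ys"]) simp
  qed
  have reach_incident: "reach U W" if "is_object U" "is_object W" "Pi_incident {0, p0} U W" for U W
    unfolding reach_def using that
    by (intro exI[of _ "if U = W then [U] else [U, W]"]) (auto simp: is_path_def)
  note sym = Pi.incident_sym[unfolded Pi_geometry_simps]
  have reach_points: "reach {0, a} {0, b}" if ab: "point a" "point b" for a b
  proof (cases "a = b")
    case True
    then show ?thesis using reach_incident[of "{0, a}" "{0, b}"] point_object[OF ab(1)]
      by (simp add: Pi_incident_def)
  next
    case False
    note L = line_object(1)[OF ab False] 
    have "Pi_incident {0, p0} {0, a} (line a b)" "Pi_incident {0, p0} (line a b) {0, b}"
      using point_incident[OF L] ab sym by auto
    then show ?thesis using reach_trans reach_incident L point_object ab by blast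
  qed
  have "reach U W" if U: "is_object U" and W: "is_object W" for U W
  proof -
    obtain a b where a: "a \<in> U" "point a" and b: "b \<in> W" "point b"
      using U W by (auto simp: is_object_iff)
    have "reach U {0, a}" "reach {0, b} W"
      using reach_incident point_object a b U W point_incident[OF U a] point_incident[OF W b] sym by blast+
    then show ?thesis using reach_points[OF a(2) b(2)] reach_trans by blast
  qed
  moreover have "Pi_objects {0, p0} H \<noteq> {}" using exists_point point_object by blast
  ultimately show ?thesis unfolding connected_geometry_def reach_def by simp
qed

abbreviation holonomy :: "'v set list \<Rightarrow> 'f" where
  "holonomy \<equiv> path_product additive_group transition"

lemma holonomy_homotopic:
  assumes "(xs, ys) \<in> homotopy (Pi_geometry {0, p0} H)" "is_path (Pi_geometry {0, p0} H) xs"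
  shows "holonomy xs = holonomy ys"
  by (rule Pi.path_product_homotopic[OF group_additive_group _ _ assms]) (simp_all add: transition_cocycle)

lemma holonomy_append:
  "holonomy (u @ x # v) = holonomy (u @ [x]) + holonomy (x # v)"
  using path_product_append(1)[OF group_additive_group, of transition u x v] by simp

lemma transition_self:
  assumes "is_object U"
  shows "transition U U = 0"
proof -
  have "Pi_incident {0, p0} U U" by (simp add: Pi_incident_def)
  then have "transition U U + transition U U = transition U U" using transition_cocycle assms by blast
  then show ?thesis by simp
qed

lemma transition_sym:
  assumes "is_object U" "is_object W" "Pi_incident {0, p0} U W"
  shows "transition W U = transition U W"
proof -
  have "Pi_incident {0, p0} W U" "Pi_incident {0, p0} U U"
    using assms(3) by (auto simp: Pi_incident_def)
  then have "transition U W + transition W U = 0"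
    using transition_cocycle[OF assms(1,2,1,3)] transition_self[OF assms(1)] by simp
  then show ?thesis using field_cases[of "transition U W"] field_cases[of "transition W U"] by auto
qed

lemma holonomy_rev:
  "is_path (Pi_geometry {0, p0} H) xs \<Longrightarrow> holonomy (rev xs) = holonomy xs"
proof (induction xs rule: induct_list012)
  case (3 U W xs)
  have UW: "is_object U" "is_object W" "Pi_incident {0, p0} U W" "is_path (Pi_geometry {0, p0} H) (W # xs)"
    using 3(3) by (auto simp: is_path_def)
  have "holonomy (rev (U # W # xs)) = holonomy (rev (W # xs)) + holonomy [W, U]"
    using holonomy_append[of "rev xs" W "[U]"] by simp
  also have "\<dots> = holonomy (W # xs) + transition U W"
    using 3(2)[OF UW(4)] transition_sym[OF UW(1-3)] by simp
  also have "\<dots> = holonomy (U # W # xs)" by (simp add: add.commute)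
  finally show ?case .
qed simp_all

text \<open>The points \<open>a, a + d, a + e\<close> with \<open>d, e\<close> orthogonal form an isotropic triangle. Around it the
potentials at the three points cancel, and what remains is the sum of \<open>form + 1\<close> over the three pairs,
which is 1.\<close>
lemma odd_cycle:
  obtains x c where "c \<in> cycles_at (Pi_geometry {0, p0} H) x" "holonomy c = 1"
proof -
  obtain a where a: "point a" using exists_point ..
  obtain d where d: "d \<in> dir H" "d \<notin> span {}" using exists_outside_span[of "{}" "dir H"] dim_dir_H by auto
  obtain d' where d': "d' \<in> dir H" "form d d' = 1" using dir_H_nondegenerate d by auto
  obtain e where e: "e \<in> dir H" "e \<noteq> 0" "form d e = 0" "e \<noteq> d"
  proof -
    obtain e where e: "e \<in> dir H" "e \<noteq> 0" "form e d = 0" "form e d' = 0"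
      using orthogonal_to_hyperbolic_pair[OF d(1) d'] by blast
    then have "e \<noteq> d" using d' by auto
    then show ?thesis using that e form_commute by metis
  qed
  let ?b = "a + d" and ?c = "a + e"
  have pts: "point ?b" "point ?c"
    using a d e subspace_plus[OF subspace_H] by (auto simp: dir_def point_def)
  have ne: "a \<noteq> ?b" "?b \<noteq> ?c" "?c \<noteq> a" using d e by auto
  have edge: "transition {0, x} (line x y) + transition (line x y) {0, y} =
      form x y + 1 + potential {0, x} x + potential {0, y} y"
    and inc: "is_object (line x y)" "Pi_incident {0, p0} {0, x} (line x y)" "Pi_incident {0, p0} (line x y) {0, y}"
    and neq: "{0, x} \<noteq> line x y" "line x y \<noteq> {0, y}"
    if xy: "point x" "point y" "x \<noteq> y" for x y
  proof -
    note L = line_object[OF xy]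
    show 1: "is_object (line x y)" "Pi_incident {0, p0} {0, x} (line x y)" "Pi_incident {0, p0} (line x y) {0, y}"
      using L point_incident[OF L(1)] Pi.incident_sym[of "{0, y}" "line x y"] xy by auto
    have "dim {0, x} = 1" "dim {0, y} = 1" using point_object xy by blast+
    with L(2) show "{0, x} \<noteq> line x y" "line x y \<noteq> {0, y}" by auto
    have "joined (line x y) x y" using xy L(2) by (simp add: joined_def)
    then have pot: "potential (line x y) x + potential (line x y) y = form x y + 1"
      using potential_joined[OF L(1)] xy by simp
    have t1: "transition {0, x} (line x y) = potential {0, x} x + potential (line x y) x"
      by (rule transition_eq) (use 1 xy point_object in auto)
    have t2: "transition (line x y) {0, y} = potential (line x y) y + potential {0, y} y"
      by (rule transition_eq) (use 1 xy point_object in auto)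
    have "transition {0, x} (line x y) + transition (line x y) {0, y} =
       (potential (line x y) x + potential (line x y) y) + potential {0, x} x + potential {0, y} y"
      unfolding t1 t2 by (simp add: ac_simps)
    then show "transition {0, x} (line x y) + transition (line x y) {0, y} =
      form x y + 1 + potential {0, x} x + potential {0, y} y" unfolding pot .
  qed
  let ?cyc = "[{0, a}, line a ?b, {0, ?b}, line ?b ?c, {0, ?c}, line ?c a, {0, a}]"
  have "holonomy ?cyc =
    (transition {0, a} (line a ?b) + transition (line a ?b) {0, ?b}) +
    (transition {0, ?b} (line ?b ?c) + transition (line ?b ?c) {0, ?c}) +
    (transition {0, ?c} (line ?c a) + transition (line ?c a) {0, a})"
    by (simp only: path_product.simps additive_group_simps add.assoc add_0_right)
  also have "\<dots> = (form a ?b + 1 + potential {0, a} a + potential {0, ?b} ?b) +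
     (form ?b ?c + 1 + potential {0, ?b} ?b + potential {0, ?c} ?c) +
     (form ?c a + 1 + potential {0, ?c} ?c + potential {0, a} a)"
    unfolding edge[OF a pts(1) ne(1)] edge[OF pts ne(2)] edge[OF pts(2) a ne(3)] ..
  also have "\<dots> = form a ?b + form ?b ?c + form ?c a + 1"
  proof -
    have "(x + 1 + u + v) + (y + 1 + v + w) + (z + 1 + w + u) = x + y + z + 1" for x y z u v w :: 'f
      using field_cases[of u] field_cases[of v] field_cases[of w] by (auto simp: ac_simps)
    then show ?thesis .
  qed
  also have "\<dots> = 1"
    using e(3) by (simp add: form_commute[of d a] form_commute[of e a] ac_simps)
  finally have "holonomy ?cyc = 1" .
  moreover have "?cyc \<in> cycles_at (Pi_geometry {0, p0} H) {0, a}"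
  proof -
    have o: "is_object {0, a}" "is_object {0, ?b}" "is_object {0, ?c}" using point_object a pts by blast+
    have "set ?cyc \<subseteq> Pi_objects {0, p0} H"
      using o inc(1)[OF a pts(1) ne(1)] inc(1)[OF pts ne(2)] inc(1)[OF pts(2) a ne(3)] by simp
    moreover have "successively (\<lambda>x y. x \<noteq> y \<and> Pi_incident {0, p0} x y) ?cyc"
      unfolding successively.simps
      by (intro conjI inc[OF a pts(1) ne(1)] inc[OF pts ne(2)] inc[OF pts(2) a ne(3)]
        neq[OF a pts(1) ne(1)] neq[OF pts ne(2)] neq[OF pts(2) a ne(3)] TrueI)
    ultimately show ?thesis unfolding cycles_at_def is_path_def Pi_geometry_simps by simp
  qed
  ultimately show ?thesis using that by blast
qed

lemma fundamental_group_iso: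
  assumes x: "is_object x"
  shows "fundamental_group (Pi_geometry {0, p0} H) x \<cong> integer_mod_group 2"
proof -
  let ?G = "Pi_geometry {0, p0} H"
  let ?F = "fundamental_group ?G x"
  have xG: "x \<in> objects ?G" using x by simp
  interpret F: group ?F by (rule Pi.group_fundamental_group[OF xG])
  obtain g where g_closed: "\<And>U W. U \<in> objects ?G \<Longrightarrow> W \<in> objects ?G \<Longrightarrow> incident ?G U W \<Longrightarrow> g U W \<in> carrier ?F"
    and g_cocycle: "\<And>U W X. {U, W, X} \<subseteq> objects ?G \<Longrightarrow> incident ?G U W \<Longrightarrow> incident ?G W X \<Longrightarrow> incident ?G U X \<Longrightarrow>
       g U W \<otimes>\<^bsub>?F\<^esub> g W X = g U X"
    and g_class: "\<And>c. c \<in> cycles_at ?G x \<Longrightarrow> Pi.hclass c = path_product ?F g c"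
    using Pi.edge_cocycle[OF connected xG] by blast
  obtain h t where t: "t \<in> carrier ?F" "t \<otimes>\<^bsub>?F\<^esub> t = \<one>\<^bsub>?F\<^esub>"
    and h: "\<And>U. is_object U \<Longrightarrow> h U \<in> carrier ?F"
    and gauge: "\<And>U W. is_object U \<Longrightarrow> is_object W \<Longrightarrow> Pi_incident {0, p0} U W \<Longrightarrow>
       h U \<otimes>\<^bsub>?F\<^esub> g U W \<otimes>\<^bsub>?F\<^esub> inv\<^bsub>?F\<^esub> (h W) \<in> {\<one>\<^bsub>?F\<^esub>, t}"
    by (rule edge_gauge[OF F.group_axioms, of g]) (use g_closed g_cocycle in auto)
  have gauge': "g U W \<in> carrier ?F \<and> h U \<otimes>\<^bsub>?F\<^esub> g U W \<otimes>\<^bsub>?F\<^esub> inv\<^bsub>?F\<^esub> (h W) \<in> {\<one>\<^bsub>?F\<^esub>, t}"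
    if "U \<in> objects ?G" "W \<in> objects ?G" "incident ?G U W" for U W
    using g_closed[OF that] gauge[of U W] that by simp
  have h': "h U \<in> carrier ?F" if "U \<in> objects ?G" for U
    using h that by simp
  define s where "s = inv\<^bsub>?F\<^esub> (h x) \<otimes>\<^bsub>?F\<^esub> t \<otimes>\<^bsub>?F\<^esub> h x"
  have two_classes: "Pi.hclass c \<in> {\<one>\<^bsub>?F\<^esub>, s}" if c: "c \<in> cycles_at ?G x" for c
  proof -
    let ?p = "path_product ?F g c"
    have c': "is_path ?G c" "hd c = x" "last c = x" using c by (simp_all add: cycles_at_def)
    have p: "?p \<in> carrier ?F \<and> h (hd c) \<otimes>\<^bsub>?F\<^esub> ?p \<otimes>\<^bsub>?F\<^esub> inv\<^bsub>?F\<^esub> (h (last c)) \<in> {\<one>\<^bsub>?F\<^esub>, t}"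
      by (rule path_product_gauge[OF F.group_axioms c'(1) t h' gauge'])
    then have p': "?p \<in> carrier ?F" "h x \<otimes>\<^bsub>?F\<^esub> ?p \<otimes>\<^bsub>?F\<^esub> inv\<^bsub>?F\<^esub> (h x) \<in> {\<one>\<^bsub>?F\<^esub>, t}"
      unfolding c'(2,3) by blast+
    have hx: "h x \<in> carrier ?F" by (rule h[OF x])
    have "?p = inv\<^bsub>?F\<^esub> (h x) \<otimes>\<^bsub>?F\<^esub> (h x \<otimes>\<^bsub>?F\<^esub> ?p \<otimes>\<^bsub>?F\<^esub> inv\<^bsub>?F\<^esub> (h x)) \<otimes>\<^bsub>?F\<^esub> h x"
      using p'(1) hx by (simp add: F.m_assoc) (simp add: F.m_assoc[symmetric])
    then have "?p \<in> {\<one>\<^bsub>?F\<^esub>, s}" using p'(2) hx by (auto simp: s_def)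
    then show ?thesis using g_class[OF c] by simp
  qed
  have F1: "\<one>\<^bsub>?F\<^esub> = Pi.hclass [x]" by (rule Pi.one_fundamental_group)
  obtain c where c: "c \<in> cycles_at ?G x" "holonomy c = 1"
  proof -
    \<comment> \<open>An odd cycle elsewhere is conjugated to the base object; the connecting path is traversed
      twice, so in characteristic 2 it does not contribute to the holonomy.\<close>
    obtain y b where b: "b \<in> cycles_at ?G y" "holonomy b = 1" by (rule odd_cycle)
    then have b': "is_path ?G b" "hd b = y" "last b = y" "b \<noteq> []" by (auto simp: cycles_at_def is_path_def)
    then have "y \<in> objects ?G" by (auto simp: is_path_def)
    then obtain P where P: "is_path ?G P" "hd P = x" "last P = y" "P \<noteq> []"
      using connected xG path_nonempty unfolding connected_geometry_def by metis
    have R: "is_path ?G (rev P)" "hd (rev P) = y" "last (rev P) = x" "rev P \<noteq> []"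
      using P Pi.is_path_rev by (auto simp: hd_rev last_rev)
    obtain Q where Q: "P = Q @ [y]" using P by (metis append_butlast_last_id)
    obtain b1 where b1: "b = y # b1" using b' by (cases b) auto
    obtain b2 where b2: "b = b2 @ [y]" using b' by (metis append_butlast_last_id)
    have 1: "is_path ?G (P @ tl b)" "last (P @ tl b) = y" 
      using is_path_append[OF P(1) b'(1)] last_append_tl[OF P(4) b'(4)] P b' by auto
    have "(P @ tl b) @ tl (rev P) \<in> cycles_at ?G x"
      using is_path_append[OF 1(1) R(1)] last_append_tl[OF _ R(4), of "P @ tl b"] 1 R P
      unfolding cycles_at_def by (simp del: append_assoc)
    moreover have "(P @ tl b) @ tl (rev P) = Q @ y # b1 @ rev Q" "y # b1 @ rev Q = b2 @ y # rev Q"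
      "P = Q @ [y]" "rev P = y # rev Q" "b2 @ [y] = b"
      using Q b1 b2 by auto
    then have "holonomy ((P @ tl b) @ tl (rev P)) = holonomy P + (holonomy b + holonomy (rev P))"
      using holonomy_append[of Q y "b1 @ rev Q"] holonomy_append[of b2 y "rev Q"] by metis
    then have "holonomy ((P @ tl b) @ tl (rev P)) = 1"
      using holonomy_rev[OF P(1)] b(2) by (simp add: ac_simps)
    ultimately show ?thesis using that by blast
  qed
  have c_path: "is_path ?G c" using c by (simp add: cycles_at_def)
  have "Pi.hclass c \<noteq> \<one>\<^bsub>?F\<^esub>"
  proof
    assume "Pi.hclass c = \<one>\<^bsub>?F\<^esub>"
    then have "(c, [x]) \<in> homotopy ?G" unfolding F1 Pi.hclass_eq_iff .
    from holonomy_homotopic[OF this c_path] c(2) show False by simp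
  qed
  then have s: "Pi.hclass c = s" "s \<noteq> \<one>\<^bsub>?F\<^esub>" using two_classes[OF c(1)] by auto
  have "carrier ?F = {\<one>\<^bsub>?F\<^esub>, s}"
    using two_classes s c(1) F.one_closed unfolding Pi.carrier_fundamental_group by blast
  then show ?thesis using F.order_2_iso_integer_mod_group s(2) by blast
qed

end

theorem corollary4p13:
  fixes scale :: "'f::field \<Rightarrow> 'v::ab_group_add \<Rightarrow> 'v"
    and form :: "'v \<Rightarrow> 'v \<Rightarrow> 'f"
    and p H :: "'v set"
  assumes "CARD('f) = 2"
    and "symplectic_space scale form"
    and "vector_space.dim scale (UNIV :: 'v set) = 6"
    and "module.subspace scale p" and "vector_space.dim scale p = 1"
    and "symplectic_space.is_complement scale H p"
  shows "connected_geometry (symplectic_space.Pi_geometry scale form p H) \<and>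
    (\<forall>x \<in> objects (symplectic_space.Pi_geometry scale form p H).
       fundamental_group (symplectic_space.Pi_geometry scale form p H) x
         \<cong> integer_mod_group 2)"
proof -
  interpret symplectic_space scale form by fact
  have f2: "a = 0 \<or> a = 1" for a :: 'f
  proof -
    have "finite (UNIV :: 'f set)" using assms(1) by (metis card.infinite zero_neq_numeral)
    then have "{0, 1} = (UNIV :: 'f set)" by (intro card_subset_eq) (use assms(1) in auto)
    then show ?thesis by blast
  qed
  have comp: "subspace H" "p \<inter> H = {0}" "{u + w | u w. u \<in> p \<and> w \<in> H} = UNIV"
    using assms(6) unfolding is_complement_def by blast+
  obtain p0 where p0: "p0 \<noteq> 0" "p = {0, p0}"
  proof -
    obtain B where B: "B \<subseteq> p" "independent B" "p \<subseteq> span B" "card B = dim p"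
      using basis_exists by blast
    then obtain b where b: "B = {b}" using assms(5) by (metis card_1_singletonE)
    have "b \<noteq> 0" using B(2) b dependent_zero by blast
    have "span B = p" using B assms(4) span_minimal by blast
    moreover have "span {b} = {0, b}"
    proof -
      have U: "(UNIV :: 'f set) = {0, 1}" using f2 by blast
      show ?thesis unfolding span_singleton U by simp
    qed
    ultimately show ?thesis using that \<open>b \<noteq> 0\<close> unfolding b by blast
  qed
  interpret hyperplane_complement scale form p0 H
  proof
    fix x
    show "x \<in> H \<or> p0 + x \<in> H"
    proof -
      obtain u w where uw: "x = u + w" "u \<in> {0, p0}" "w \<in> H" using comp(3) p0 by blast
      have "(1 :: 'f) + 1 = 0" using f2[of "1 + 1"] by (metis add_cancel_right_right zero_neq_one)
      then have "p0 + p0 = 0"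
        using scale_left_distrib[of 1 1 p0] by simp
      then have "p0 + (p0 + w) = w" by (simp add: add.assoc[symmetric])
      with uw show ?thesis by (metis add_0 empty_iff insert_iff)
    qed
    show "p0 \<notin> H" using comp(2) p0 by blast
  qed (fact assms(1) assms(3) comp(1) p0(1))+
  show ?thesis using connected fundamental_group_iso p0 by simp
qed

end
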